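(* Let $P_{Y_1,Y_2,Z|X_1,X_2}$ be a channel whose alphabets $\mathcal X_1,\mathcal X_2,\mathcal Y_1,\mathcal Y_2$ are finite fields, and assume it is conditionally independent, i.e. $$P_{Y_1,Y_2,Z|X_1,X_2}(y_1,y_2,z|x_1,x_2)=P_{Y_1|X_1,X_2}(y_1|x_1,x_2)\,P_{Y_2|X_1,X_2}(y_2|x_1,x_2)\,P_{Z|X_1,X_2}(z|x_1,x_2).$$ Let $P_{X_1},P_{X_2}$ be distributions on $\mathcal X_1,\mathcal X_2$. Let $X_1\sim P_{X_1}$ and $X_2\sim P_{X_2}$ be independent and let $(Y_1,Y_2,Z)$ be the corresponding channel outputs. Let $(V_1,X_1',Y_1')$ and $(V_2,X_2',Y_2')$, with $(X_i',Y_i')\in\mathcal X_i\times\mathcal Y_i$, be independent of each other and of $(X_1,X_2,Y_1,Y_2,Z)$, and put $X_i'':=X_i\oplus X_i'$, $Y_i'':=Y_i\oplus Y_i'$ for $i=1,2$. Assume that $V_1$ takes values in $\mathcal V_1=\mathcal Y_1$ and $V_2$ takes values in $\mathcal V_2=\{0\}$, that $$P_{X_1',Y_1',V_1}(x_1,y_1,v_1)=\frac1{|\mathcal Y_1|}\,\delta_{x_1,0}\,\delta_{y_1,v_1},$$ and that $P_{X_2',Y_2'|V_2=0}$ is the uniform distribution on $\mathcal X_2\times\mathcal Y_2$. Then $$I(V_1;X_2,Y_2,X_1'',Y_1''|X_2',Y_2')-I(V_1,V_2;Z,X_1'',Y_1'',X_2'',Y_2'')=I(Y_1;X_2|X_1)-I(Y_1;Z|X_1)>0$$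 and $$I(V_2;X_1,Y_1,X_2'',Y_2''|X_1',Y_1')=0.$$ The same result holds with the roles of User 1 and User 2 exchanged (i.e. with the indices $1$ and $2$ interchanged throughout).
   Context: The channel $P_{Y_1,Y_2,Z|X_1,X_2}$ is a two-way wiretap channel: User $i$ inputs $X_i\in\mathcal X_i$ and receives $Y_i\in\mathcal Y_i$ for $i=1,2$, and an eavesdropper receives $Z\in\mathcal Z$ ($\mathcal Z$ finite). The symbol $\oplus$ denotes addition in the respective finite field, and $\delta_{x,x'}=1$ if $x=x'$ and $0$ otherwise. The variables $(X_i'',Y_i'')$ are interpreted as being sent by User $i$ over a noiseless public channel. $I(\cdot;\cdot|\cdot)$ is (conditional) Shannon mutual information.
   Formalization: The strict inequality "> 0" fails in general (e.g. if Y_1 is constant or Z = X_2); it is replaced by "≥ 0", with "> 0" exactly when Y_1 and X_2 are not conditionally independent given (X_1, Z), and likewise with the users exchanged. *)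

theory Defs
  imports "HOL-Probability.Probability"
begin

text \<open>
  All alphabets are countable types with the discrete sigma-algebra. Entropic quantities are the
  library ones, with logarithms to an arbitrary base \<open>b > 1\<close>; outside the locale
  \<^locale>\<open>information_space\<close> they need \<open>M\<close> and \<open>b\<close> as explicit arguments.
\<close>

abbreviation MI :: "real \<Rightarrow> 'w measure \<Rightarrow> ('w \<Rightarrow> 'a) \<Rightarrow> ('w \<Rightarrow> 'b) \<Rightarrow> real" where
  "MI b M X Y \<equiv> prob_space.mutual_information M b
     (count_space (X ` space M)) (count_space (Y ` space M)) X Y"

abbreviation CMI ::
    "real \<Rightarrow> 'w measure \<Rightarrow> ('w \<Rightarrow> 'a) \<Rightarrow> ('w \<Rightarrow> 'b) \<Rightarrow> ('w \<Rightarrow> 'c) \<Rightarrow> real" where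
  "CMI b M X Y Z \<equiv> prob_space.conditional_mutual_information M b
     (count_space (X ` space M)) (count_space (Y ` space M)) (count_space (Z ` space M)) X Y Z"

abbreviation rv_add :: "('w \<Rightarrow> 'a::plus) \<Rightarrow> ('w \<Rightarrow> 'a) \<Rightarrow> 'w \<Rightarrow> 'a" (infixl \<open>\<oplus>\<close> 65) where
  "X \<oplus> X' \<equiv> (\<lambda>\<omega>. X \<omega> + X' \<omega>)"

type_synonym ('x1, 'x2, 'y1, 'y2, 'z) two_way_channel = "'x1 \<Rightarrow> 'x2 \<Rightarrow> ('y1 \<times> 'y2 \<times> 'z) pmf"

definition cond_indep_channel :: "('x1, 'x2, 'y1, 'y2, 'z) two_way_channel \<Rightarrow> bool" where
  "cond_indep_channel W \<longleftrightarrow>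
     (\<forall>x1 x2 y1 y2 z. pmf (W x1 x2) (y1, y2, z) =
        pmf (map_pmf (\<lambda>(y1, y2, z). y1) (W x1 x2)) y1 *
        pmf (map_pmf (\<lambda>(y1, y2, z). y2) (W x1 x2)) y2 *
        pmf (map_pmf (\<lambda>(y1, y2, z). z) (W x1 x2)) z)"

text \<open>
  The inputs are independent with laws \<open>P1\<close> and \<open>P2\<close>, and \<open>(Y1, Y2, Z)\<close> is the output of the
  channel \<open>W\<close> on them.
\<close>

definition channel_use ::
    "'w measure \<Rightarrow> ('x1, 'x2, 'y1, 'y2, 'z) two_way_channel \<Rightarrow> 'x1 pmf \<Rightarrow> 'x2 pmf \<Rightarrow>
     ('w \<Rightarrow> 'x1) \<Rightarrow> ('w \<Rightarrow> 'x2) \<Rightarrow> ('w \<Rightarrow> 'y1) \<Rightarrow> ('w \<Rightarrow> 'y2) \<Rightarrow> ('w \<Rightarrow> 'z) \<Rightarrow> bool" where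
  "channel_use M W P1 P2 X1 X2 Y1 Y2 Z \<longleftrightarrow>
     (\<lambda>\<omega>. (X1 \<omega>, X2 \<omega>, Y1 \<omega>, Y2 \<omega>, Z \<omega>)) \<in> measurable M (count_space UNIV) \<and>
     (\<forall>x1 x2 y1 y2 z.
        \<P>(\<omega> in M. X1 \<omega> = x1 \<and> X2 \<omega> = x2 \<and> Y1 \<omega> = y1 \<and> Y2 \<omega> = y2 \<and> Z \<omega> = z) =
        pmf P1 x1 * pmf P2 x2 * pmf (W x1 x2) (y1, y2, z))"

text \<open>
  Mutual independence of three variables. Their value types differ, so
  \<^const>\<open>prob_space.indep_vars\<close> is not applicable; independence is stated for the families of
  events that they generate. \<^const>\<open>prob_space.indep_sets\<close> includes that these are events,
  i.e. measurability with respect to the discrete sigma-algebras.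
\<close>

definition rv_events :: "'w measure \<Rightarrow> ('w \<Rightarrow> 'a) \<Rightarrow> 'w set set" where
  "rv_events M A = {A -` S \<inter> space M | S. S \<in> UNIV}"

definition indep_triple ::
    "'w measure \<Rightarrow> ('w \<Rightarrow> 'a) \<Rightarrow> ('w \<Rightarrow> 'b) \<Rightarrow> ('w \<Rightarrow> 'c) \<Rightarrow> bool" where
  "indep_triple M A B C \<longleftrightarrow>
     prob_space.indep_sets M (\<lambda>i. [rv_events M A, rv_events M B, rv_events M C] ! i) {0, 1, 2}"

text \<open>
  The sending user: \<open>P(X' = x, Y' = y, V = v) = \<delta>(x,0) \<delta>(y,v) / |\<Y>|\<close>.
\<close>

definition sender_aux ::
    "'w measure \<Rightarrow> ('w \<Rightarrow> 'y::{finite,field}) \<Rightarrow> ('w \<Rightarrow> 'x::{finite,field}) \<Rightarrow> ('w \<Rightarrow> 'y) \<Rightarrow> bool"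
  where
  "sender_aux M V X' Y' \<longleftrightarrow>
     (\<forall>x y v. \<P>(\<omega> in M. X' \<omega> = x \<and> Y' \<omega> = y \<and> V \<omega> = v) =
        1 / real CARD('y) * of_bool (x = 0) * of_bool (y = v))"

text \<open>The other user: \<open>V\<close> takes values in the singleton \<open>{0}\<close>.\<close>

definition helper_aux ::
    "'w measure \<Rightarrow> ('w \<Rightarrow> nat) \<Rightarrow> ('w \<Rightarrow> 'x::{finite,field}) \<Rightarrow> ('w \<Rightarrow> 'y::{finite,field}) \<Rightarrow> bool"
  where
  "helper_aux M V X' Y' \<longleftrightarrow>
     V \<in> space M \<rightarrow> {0} \<and>
     (\<forall>x y. \<P>(\<omega> in M. X' \<omega> = x \<and> Y' \<omega> = y \<bar> V \<omega> = 0) = 1 / (real CARD('x) * real CARD('y)))"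

text \<open>
  Conditional independence of \<open>A\<close> and \<open>B\<close> given \<open>C\<close>. If \<open>P(C = c) = 0\<close>, all conditional
  probabilities in the equation are \<open>0\<close> and it holds.
\<close>

definition cond_indep_rv ::
    "'w measure \<Rightarrow> ('w \<Rightarrow> 'a) \<Rightarrow> ('w \<Rightarrow> 'b) \<Rightarrow> ('w \<Rightarrow> 'c) \<Rightarrow> bool" where
  "cond_indep_rv M A B C \<longleftrightarrow>
     (\<forall>a b c. \<P>(\<omega> in M. A \<omega> = a \<and> B \<omega> = b \<bar> C \<omega> = c) =
        \<P>(\<omega> in M. A \<omega> = a \<bar> C \<omega> = c) * \<P>(\<omega> in M. B \<omega> = b \<bar> C \<omega> = c))"

end

theory Submission
  imports Defs
begin

text \<open>
  All variables have finite range, so the quantities in question are signed sums of entropies of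
  images of one joint law. Since \<open>V1 = Y1'\<close> and \<open>(X2', Y2')\<close> are uniform and independent of the
  channel variables, they act as one-time pads: up to the common summand \<open>H(V1)\<close>, the first
  information is \<open>- H(Y1 | X1, X2, Y2)\<close> and the leakage is \<open>- H(Y1 | X1, Z)\<close>. As \<open>Y1\<close> is independent
  of \<open>Y2\<close> given the inputs, their difference is \<open>I(Y1; X2 | X1) - I(Y1; Z | X1)\<close>; as \<open>Y1\<close> is also
  independent of \<open>Z\<close> given the inputs, it equals \<open>I(Y1; X2 | X1, Z)\<close>, whose sign is determined by
  Gibbs' inequality and its equality case.
\<close>

section \<open>Entropy of finite distributions\<close>

text \<open>The public symbol \<open>Y1''\<close> is worth different things depending on whether
  \<open>V1\<close> is known. Without \<open>V1\<close> it is a fresh uniform symbol, independent of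
  all the rest; with \<open>V1\<close> the mask can be subtracted and it is as good as
  \<open>Y1\<close>. An information with \<open>V1\<close> is therefore \<open>H(V1)\<close> plus
  the entropy of the other data without \<open>Y1\<close> minus their entropy with
  \<open>Y1\<close>, for User 2 and for the eavesdropper alike. The pad \<open>(X2', Y2')\<close>
  separates the two: User 2 knows it and keeps \<open>X2, Y2\<close>, whereas for the eavesdropper
  it turns the public symbols of User 2 into noise.

  The sign comes from the chain rule: expanding \<open>I(Y1; X2, Z | X1)\<close> in both orders,
  with \<open>I(Y1; Z | X1, X2) = 0\<close>, gives
  \<open>I(Y1; X2 | X1) - I(Y1; Z | X1) = I(Y1; X2 | X1, Z)\<close>.

  The library informations live on an arbitrary space \<open>M\<close> and are sums over ranges.
  Once every variable is a function of one tuple with a known \<open>pmf\<close>, an identity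
  between informations is linear arithmetic over finitely many entropies, up to recoding of their
  arguments.\<close>

definition pmf_entropy :: "real \<Rightarrow> 'a pmf \<Rightarrow> real" where
  "pmf_entropy b p = - measure_pmf.expectation p (\<lambda>x. log b (pmf p x))"

text \<open>Pulls the entropy of an image back to an expectation over the base law, so that
  entropies of different images can be combined under one integral.\<close>

lemma pmf_entropy_map:
  "pmf_entropy b (map_pmf f p) = - measure_pmf.expectation p (\<lambda>x. log b (pmf (map_pmf f p) (f x)))"
  by (simp add: pmf_entropy_def)

lemma pmf_entropy_pair:
  assumes "finite (set_pmf p)" "finite (set_pmf q)" "1 < b"
  shows "pmf_entropy b (pair_pmf p q) = pmf_entropy b p + pmf_entropy b q"
proof -
  let ?E = "measure_pmf.expectation (pair_pmf p q)"
  have int: "integrable (measure_pmf (pair_pmf p q)) f" for f :: "_ \<Rightarrow> real"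
    using assms by (intro integrable_measure_pmf_finite) auto
  \<comment> \<open>The logarithm of the product is split only on the support, where both factors
    are nonzero.\<close>
  have "?E (\<lambda>x. log b (pmf (pair_pmf p q) x)) =
      ?E (\<lambda>x. log b (pmf p (fst x)) + log b (pmf q (snd x)))"
    using assms
    by (intro integral_cong_AE) (auto simp: AE_measure_pmf_iff pmf_pair log_mult set_pmf_iff)
  also have "\<dots> = ?E (\<lambda>x. log b (pmf p (fst x))) + ?E (\<lambda>x. log b (pmf q (snd x)))"
    by (intro Bochner_Integration.integral_add int)
  finally show ?thesis
    by (simp add: pmf_entropy_def expectation_pair_pmf_fst[of _ _ "\<lambda>x. log b (pmf p x)"]
      expectation_pair_pmf_snd[of _ _ "\<lambda>x. log b (pmf q x)"])
qed

lemma pmf_map_pos: "x \<in> set_pmf p \<Longrightarrow> 0 < pmf (map_pmf f p) (f x)"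
  by (simp add: pmf_positive)

text \<open>Encoded by entropies and not as a divergence, which makes relations between informations
  linear. The divergence form, needed for the sign, is recovered in
  \<open>pmf_cmi_eq_expectation\<close>.\<close>

definition pmf_cmi :: "real \<Rightarrow> 'w pmf \<Rightarrow> ('w \<Rightarrow> 'a) \<Rightarrow> ('w \<Rightarrow> 'b) \<Rightarrow> ('w \<Rightarrow> 'c) \<Rightarrow> real" where
  "pmf_cmi b p f g h =
     pmf_entropy b (map_pmf (\<lambda>t. (f t, h t)) p) + pmf_entropy b (map_pmf (\<lambda>t. (g t, h t)) p)
     - pmf_entropy b (map_pmf (\<lambda>t. (f t, g t, h t)) p) - pmf_entropy b (map_pmf h p)"

text \<open>The cross-multiplied form avoids division: for \<open>z\<close> of probability 0 both
  sides vanish.\<close>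

definition pmf_cond_indep :: "'w pmf \<Rightarrow> ('w \<Rightarrow> 'a) \<Rightarrow> ('w \<Rightarrow> 'b) \<Rightarrow> ('w \<Rightarrow> 'c) \<Rightarrow> bool" where
  "pmf_cond_indep p f g h \<longleftrightarrow>
     (\<forall>x y z. pmf (map_pmf (\<lambda>t. (f t, g t, h t)) p) (x, y, z) * pmf (map_pmf h p) z =
       pmf (map_pmf (\<lambda>t. (f t, h t)) p) (x, z) * pmf (map_pmf (\<lambda>t. (g t, h t)) p) (y, z))"

text \<open>The bracketing of the denominator is that of the library formula used in
  \<open>CMI_eq_pmf_cmi\<close>. It is also the law that keeps the pairs \<open>(f, h)\<close> and
  \<open>(g, h)\<close> but makes \<open>f\<close> and \<open>g\<close> independent given
  \<open>h\<close>, the reference law for Gibbs' inequality.\<close>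

lemma pmf_cmi_eq_expectation:
  assumes "finite (set_pmf p)" "1 < b"
  shows "pmf_cmi b p f g h = measure_pmf.expectation p (\<lambda>t.
     log b (pmf (map_pmf (\<lambda>t. (f t, g t, h t)) p) (f t, g t, h t) /
       (pmf (map_pmf (\<lambda>t. (f t, h t)) p) (f t, h t) *
         (pmf (map_pmf (\<lambda>t. (g t, h t)) p) (g t, h t) / pmf (map_pmf h p) (h t)))))"
proof -
  let ?F = "\<lambda>t. log b (pmf (map_pmf (\<lambda>t. (f t, h t)) p) (f t, h t))"
  let ?G = "\<lambda>t. log b (pmf (map_pmf (\<lambda>t. (g t, h t)) p) (g t, h t))"
  let ?FG = "\<lambda>t. log b (pmf (map_pmf (\<lambda>t. (f t, g t, h t)) p) (f t, g t, h t))"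
  let ?H = "\<lambda>t. log b (pmf (map_pmf h p) (h t))"
  have int: "integrable (measure_pmf p) k" for k :: "_ \<Rightarrow> real"
    using assms by (intro integrable_measure_pmf_finite) auto
  have "pmf_cmi b p f g h = measure_pmf.expectation p (\<lambda>t. ?FG t + ?H t - ?F t - ?G t)"
    by (simp add: pmf_cmi_def pmf_entropy_map int)
  also have "\<dots> = measure_pmf.expectation p (\<lambda>t.
     log b (pmf (map_pmf (\<lambda>t. (f t, g t, h t)) p) (f t, g t, h t) /
       (pmf (map_pmf (\<lambda>t. (f t, h t)) p) (f t, h t) *
         (pmf (map_pmf (\<lambda>t. (g t, h t)) p) (g t, h t) / pmf (map_pmf h p) (h t)))))"
  proof (intro integral_cong_AE)
    show "AE t in measure_pmf p. ?FG t + ?H t - ?F t - ?G t =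
      log b (pmf (map_pmf (\<lambda>t. (f t, g t, h t)) p) (f t, g t, h t) /
       (pmf (map_pmf (\<lambda>t. (f t, h t)) p) (f t, h t) *
         (pmf (map_pmf (\<lambda>t. (g t, h t)) p) (g t, h t) / pmf (map_pmf h p) (h t))))"
      unfolding AE_measure_pmf_iff
    proof
      fix t assume t: "t \<in> set_pmf p"
      note pos = pmf_map_pos[OF t]
      show "?FG t + ?H t - ?F t - ?G t =
      log b (pmf (map_pmf (\<lambda>t. (f t, g t, h t)) p) (f t, g t, h t) /
       (pmf (map_pmf (\<lambda>t. (f t, h t)) p) (f t, h t) *
         (pmf (map_pmf (\<lambda>t. (g t, h t)) p) (g t, h t) / pmf (map_pmf h p) (h t))))"
        using pos[of "\<lambda>t. (f t, g t, h t)"] pos[of "\<lambda>t. (f t, h t)"] pos[of "\<lambda>t. (g t, h t)"]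
          pos[of h] assms
        by (simp add: log_divide_pos log_mult_pos)
    qed
  qed simp_all
  finally show ?thesis .
qed

section \<open>Gibbs' inequality and its equality case\<close>

text \<open>This is \<open>ln x \<le> x - 1\<close> at \<open>x = r / q\<close>, with equality only
  at 1. The correction \<open>- q + r\<close> makes each single term nonnegative, so that equality
  can be read off termwise. The third assumption excludes \<open>q > 0 = r\<close>, where the
  convention \<open>q / 0 = 0\<close> would leave the value \<open>- q\<close>.\<close>

lemma gibbs_pointwise:
  assumes "0 \<le> q" "0 \<le> r" "r = 0 \<Longrightarrow> q = 0"
  shows "0 \<le> q * ln (q / r) - q + r" and "q * ln (q / r) - q + r = 0 \<longleftrightarrow> q = (r::real)"
proof -
  have "0 \<le> q * ln (q / r) - q + r \<and> (q * ln (q / r) - q + r = 0 \<longleftrightarrow> q = r)"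
  proof (cases "q = 0")
    case False
    then have q: "0 < q" and r: "0 < r"
      using assms by (auto simp: less_le)
    have eq: "q * ln (q / r) - q + r = q * (r / q - 1 - ln (r / q))"
      using q r by (simp add: field_simps ln_div)
    have "r / q - 1 - ln (r / q) = 0 \<longleftrightarrow> q = r"
      using q r ln_eq_minus_one[of "r / q"] by auto
    then show ?thesis
      unfolding eq using q r ln_le_minus_one[of "r / q"] by simp
  qed (use assms in auto)
  then show "0 \<le> q * ln (q / r) - q + r" "q * ln (q / r) - q + r = 0 \<longleftrightarrow> q = r"
    by auto
qed

text \<open>Since \<open>q\<close> and \<open>r\<close> have equal mass, the corrections of
  \<open>gibbs_pointwise\<close> cancel in the sum, and the relative entropy is a sum of nonnegative
  terms divided by \<open>ln b\<close>.\<close>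

lemma gibbs:
  fixes q r :: "'a \<Rightarrow> real"
  assumes "finite A" "1 < b"
    and "\<And>x. x \<in> A \<Longrightarrow> 0 \<le> q x" "\<And>x. x \<in> A \<Longrightarrow> 0 \<le> r x"
    and "\<And>x. x \<in> A \<Longrightarrow> r x = 0 \<Longrightarrow> q x = 0"
    and "sum q A = sum r A"
  shows "0 \<le> (\<Sum>x\<in>A. q x * log b (q x / r x))"
    and "(\<Sum>x\<in>A. q x * log b (q x / r x)) = 0 \<longleftrightarrow> (\<forall>x\<in>A. q x = r x)"
proof -
  let ?d = "\<lambda>x. q x * ln (q x / r x) - q x + r x"
  have "(\<Sum>x\<in>A. q x * log b (q x / r x)) = (\<Sum>x\<in>A. q x * ln (q x / r x)) / ln b"
    by (simp add: log_def sum_divide_distrib)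
  also have "(\<Sum>x\<in>A. q x * ln (q x / r x)) = sum ?d A"
    using assms(6) by (simp add: sum.distrib sum_subtractf)
  finally have eq: "(\<Sum>x\<in>A. q x * log b (q x / r x)) = sum ?d A / ln b" .
  have nn: "0 \<le> ?d x" if "x \<in> A" for x
    using gibbs_pointwise(1) assms that by blast
  show "0 \<le> (\<Sum>x\<in>A. q x * log b (q x / r x))"
    unfolding eq using \<open>1 < b\<close> nn by (intro divide_nonneg_nonneg sum_nonneg) auto
  have "sum ?d A = 0 \<longleftrightarrow> (\<forall>x\<in>A. ?d x = 0)"
    using assms(1) nn by (intro sum_nonneg_eq_0_iff) auto
  also have "\<dots> \<longleftrightarrow> (\<forall>x\<in>A. q x = r x)"
    using gibbs_pointwise(2) assms by (intro ball_cong) blast+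
  finally show "(\<Sum>x\<in>A. q x * log b (q x / r x)) = 0 \<longleftrightarrow> (\<forall>x\<in>A. q x = r x)"
    unfolding eq using \<open>1 < b\<close> by simp
qed

text \<open>The fibres of \<open>f\<close> partition the event \<open>h t = z\<close>. Later a
  variable is moved to the first component before it is summed out.\<close>

lemma sum_pmf_map_Pair:
  fixes f :: "'w \<Rightarrow> 'a::finite"
  shows "(\<Sum>x\<in>UNIV. pmf (map_pmf (\<lambda>t. (f t, h t)) p) (x, z)) = pmf (map_pmf h p) z"
proof -
  have "(\<Sum>x\<in>UNIV. pmf (map_pmf (\<lambda>t. (f t, h t)) p) (x, z)) =
      (\<Sum>x\<in>UNIV. measure (measure_pmf p) {t. f t = x \<and> h t = z})"
    by (simp add: pmf_map vimage_def)
  also have "\<dots> = measure (measure_pmf p) (\<Union>x\<in>UNIV. {t. f t = x \<and> h t = z})"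
    by (intro measure_pmf.finite_measure_finite_Union[symmetric]) (auto simp: disjoint_family_on_def)
  also have "(\<Union>x\<in>UNIV. {t. f t = x \<and> h t = z}) = h -` {z}"
    by auto
  finally show ?thesis
    by (simp add: pmf_map)
qed

text \<open>Since \<open>h\<close> is a coarsening of \<open>f\<close>, a null value of
  \<open>h\<close> has only null values of \<open>f\<close> above it. This settles the cases of
  vanishing denominators.\<close>

lemma pmf_map_comp_zero:
  assumes "pmf (map_pmf h p) (k y) = 0" "\<And>t. h t = k (f t)"
  shows "pmf (map_pmf f p) y = 0"
  using assms by (auto simp: pmf_eq_0_set_pmf)

text \<open>The information is the relative entropy of the joint law \<open>?q\<close> with respect
  to \<open>?r\<close>, so Gibbs' inequality applies once \<open>?r\<close> is known to have mass 1
  and to dominate \<open>?q\<close>. Equality \<open>?q = ?r\<close> is conditional independence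
  with the denominator cleared.\<close>

lemma pmf_cmi_Gibbs:
  fixes f :: "'w \<Rightarrow> 'a::finite" and g :: "'w \<Rightarrow> 'b::finite" and h :: "'w \<Rightarrow> 'c::finite"
  assumes "finite (set_pmf p)" "1 < b"
  shows "0 \<le> pmf_cmi b p f g h" and "pmf_cmi b p f g h = 0 \<longleftrightarrow> pmf_cond_indep p f g h"
proof -
  let ?q = "pmf (map_pmf (\<lambda>t. (f t, g t, h t)) p)"
  let ?qf = "pmf (map_pmf (\<lambda>t. (f t, h t)) p)"
  let ?qg = "pmf (map_pmf (\<lambda>t. (g t, h t)) p)"
  let ?qh = "pmf (map_pmf h p)"
  let ?r = "\<lambda>(x, y, z). ?qf (x, z) * (?qg (y, z) / ?qh z)"
  have qf0: "?qf (x, z) = 0" if "?qh z = 0" for x z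
    by (rule pmf_map_comp_zero[where k = snd and h = h]) (use that in auto)
  have qg0: "?qg (y, z) = 0" if "?qh z = 0" for y z
    by (rule pmf_map_comp_zero[where k = snd and h = h]) (use that in auto)
  have q0: "?q (x, y, z) = 0" if "?qf (x, z) = 0 \<or> ?qg (y, z) = 0 \<or> ?qh z = 0" for x y z
    using that
  proof (elim disjE)
    assume "?qf (x, z) = 0"
    then show ?thesis
      by (intro pmf_map_comp_zero[where k = "\<lambda>(x, y, z). (x, z)" and h = "\<lambda>t. (f t, h t)"]) auto
  next
    assume "?qg (y, z) = 0"
    then show ?thesis
      by (intro pmf_map_comp_zero[where k = "\<lambda>(x, y, z). (y, z)" and h = "\<lambda>t. (g t, h t)"]) auto
  next
    assume "?qh z = 0"
    then show ?thesis
      by (intro pmf_map_comp_zero[where k = "\<lambda>(x, y, z). z" and h = h]) auto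
  qed
  have eq: "pmf_cmi b p f g h = (\<Sum>t\<in>UNIV. ?q t * log b (?q t / ?r t))"
  proof -
    have "pmf_cmi b p f g h =
      measure_pmf.expectation (map_pmf (\<lambda>t. (f t, g t, h t)) p) (\<lambda>t. log b (?q t / ?r t))"
      by (simp add: pmf_cmi_eq_expectation[OF assms])
    also have "\<dots> = (\<Sum>t\<in>UNIV. log b (?q t / ?r t) * ?q t)"
      by (rule integral_measure_pmf_real) auto
    finally show ?thesis
      by (simp add: mult.commute)
  qed
  have sum1: "sum ?q UNIV = 1"
    by (rule sum_pmf_eq_1) auto
  have "sum ?r UNIV = (\<Sum>z\<in>UNIV. \<Sum>y\<in>UNIV. \<Sum>x\<in>UNIV. ?r (x, y, z))"
    unfolding UNIV_Times_UNIV[symmetric] sum.cartesian_product'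
    by (subst sum.swap, subst (2) sum.swap, subst sum.swap) (rule refl)
  also have "\<dots> = (\<Sum>z\<in>UNIV. \<Sum>y\<in>UNIV. ?qh z * (?qg (y, z) / ?qh z))"
    by (simp add: sum_distrib_right[symmetric] sum_pmf_map_Pair[of f] del: times_divide_eq_right)
  \<comment> \<open>Where \<open>?qh z = 0\<close> the factor does not cancel, but there
    \<open>?qg (y, z)\<close> is 0 as well.\<close>
  also have "\<dots> = (\<Sum>z\<in>UNIV. \<Sum>y\<in>UNIV. ?qg (y, z))"
    by (intro sum.cong) (auto simp: qg0)
  also have "\<dots> = (\<Sum>z\<in>UNIV. ?qh z)"
    by (simp add: sum_pmf_map_Pair)
  also have "\<dots> = 1"
    by (rule sum_pmf_eq_1) auto
  finally have sums: "sum ?q UNIV = sum ?r UNIV"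
    using sum1 by simp
  have r0: "?q t = 0" if "?r t = 0" for t
    using that q0 by (cases t) auto
  have nn: "0 \<le> ?r t" for t
    by (auto split: prod.split)
  note gb = gibbs[where A = UNIV and q = ?q and r = ?r, OF _ \<open>1 < b\<close> _ _ _ sums]
  show "0 \<le> pmf_cmi b p f g h"
    unfolding eq using r0 nn by (intro gb(1)) auto
  have "pmf_cmi b p f g h = 0 \<longleftrightarrow> (\<forall>t. ?q t = ?r t)"
    unfolding eq using r0 nn gb(2) by simp
  also have "\<dots> \<longleftrightarrow> (\<forall>x y z. ?q (x, y, z) * ?qh z = ?qf (x, z) * ?qg (y, z))"
  proof -
    have "?q (x, y, z) = ?r (x, y, z) \<longleftrightarrow> ?q (x, y, z) * ?qh z = ?qf (x, z) * ?qg (y, z)" for x y z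
      by (cases "?qh z = 0") (auto simp: qf0 qg0 q0 field_simps)
    then show ?thesis
      by (simp only: split_paired_All)
  qed
  finally show "pmf_cmi b p f g h = 0 \<longleftrightarrow> pmf_cond_indep p f g h"
    by (simp add: pmf_cond_indep_def)
qed

section \<open>Entropy under recoding, factorisation and masking\<close>

text \<open>Entropy depends only on the partition that a map induces on the support, because
  \<open>pmf (map_pmf f p) (f t)\<close> is the mass of the fibre of \<open>t\<close>. All later
  recodings rest on this: reordering components, dropping constants, and subtracting a known
  mask.\<close>

lemma pmf_entropy_map_cong:
  assumes "\<And>s t. s \<in> set_pmf p \<Longrightarrow> t \<in> set_pmf p \<Longrightarrow> f s = f t \<longleftrightarrow> g s = g t"
  shows "pmf_entropy b (map_pmf f p) = pmf_entropy b (map_pmf g p)"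
proof -
  have eq: "pmf (map_pmf f p) (f t) = pmf (map_pmf g p) (g t)" if "t \<in> set_pmf p" for t
    using assms[OF _ that] unfolding pmf_map
    by (intro measure_pmf.finite_measure_eq_AE) (auto simp: AE_measure_pmf_iff)
  have "measure_pmf.expectation p (\<lambda>t. log b (pmf (map_pmf f p) (f t)))
      = measure_pmf.expectation p (\<lambda>t. log b (pmf (map_pmf g p) (g t)))"
    by (intro integral_cong_AE) (auto simp: AE_measure_pmf_iff eq)
  then show ?thesis
    by (simp add: pmf_entropy_map)
qed

lemma pmf_cmi_commute: "pmf_cmi b p f g h = pmf_cmi b p g f h"
proof -
  have "pmf_entropy b (map_pmf (\<lambda>t. (f t, g t, h t)) p) = pmf_entropy b (map_pmf (\<lambda>t. (g t, f t, h t)) p)"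
    by (rule pmf_entropy_map_cong) auto
  then show ?thesis
    by (simp add: pmf_cmi_def)
qed

lemma pmf_cmi_cong_given:
  assumes "\<And>s t. h s = h t \<longleftrightarrow> h' s = h' t"
  shows "pmf_cmi b p f g h = pmf_cmi b p f g h'"
  unfolding pmf_cmi_def
  by (intro arg_cong2[where f = "(-)"] arg_cong2[where f = "(+)"] pmf_entropy_map_cong)
    (simp_all add: assms)

lemma pmf_entropy_return: "pmf_entropy b (return_pmf c) = 0"
  by (simp add: pmf_entropy_def)

text \<open>A constant component does not refine any partition, so the four entropies cancel in
  pairs. This accounts for the zero rate of the user whose \<open>V\<close> is always 0.\<close>

lemma pmf_cmi_const: "pmf_cmi b p (\<lambda>t. c) g h = 0"
proof -
  have "pmf_entropy b (map_pmf (\<lambda>t. (c, h t)) p) = pmf_entropy b (map_pmf h p)"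
    and "pmf_entropy b (map_pmf (\<lambda>t. (c, g t, h t)) p) = pmf_entropy b (map_pmf (\<lambda>t. (g t, h t)) p)"
    by (rule pmf_entropy_map_cong; simp)+
  then show ?thesis
    by (simp add: pmf_cmi_def)
qed

text \<open>Because \<open>A z\<close> and \<open>B z\<close> are normalised, summing out
  \<open>x\<close> and \<open>y\<close> forces \<open>k z\<close> to be the mass of
  \<open>h = z\<close>; the other two marginals follow in the same way.\<close>

lemma pmf_cond_indepI:
  fixes f :: "'w \<Rightarrow> 'a::finite" and g :: "'w \<Rightarrow> 'b::finite"
  assumes eq: "\<And>x y z. pmf (map_pmf (\<lambda>t. (f t, g t, h t)) p) (x, y, z) = k z * pmf (A z) x * pmf (B z) y"
  shows "pmf_cond_indep p f g h"
proof -
  have A: "(\<Sum>x\<in>UNIV. pmf (A z) x) = 1" and B: "(\<Sum>y\<in>UNIV. pmf (B z) y) = 1" for z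
    by (auto intro: sum_pmf_eq_1)
  have g: "pmf (map_pmf (\<lambda>t. (g t, h t)) p) (y, z) = k z * pmf (B z) y" for y z
    using sum_pmf_map_Pair[of f "\<lambda>t. (g t, h t)" p "(y, z)"]
    by (simp add: eq A flip: sum_distrib_left sum_distrib_right)
  have swap: "pmf (map_pmf (\<lambda>t. (g t, f t, h t)) p) (y, x, z) =
      pmf (map_pmf (\<lambda>t. (f t, g t, h t)) p) (x, y, z)" for x y z
    by (simp add: pmf_map vimage_def conj_ac)
  have f: "pmf (map_pmf (\<lambda>t. (f t, h t)) p) (x, z) = k z * pmf (A z) x" for x z
    using sum_pmf_map_Pair[of g "\<lambda>t. (f t, h t)" p "(x, z)"]
    by (simp add: swap eq B flip: sum_distrib_left sum_distrib_right)
  have h: "pmf (map_pmf h p) z = k z" for z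
    using sum_pmf_map_Pair[of g h p z] by (simp add: g B flip: sum_distrib_left)
  show ?thesis
    by (simp add: pmf_cond_indep_def eq f g h)
qed

text \<open>For each fixed \<open>w\<close>, translation by \<open>g w\<close> permutes the group
  and preserves the uniform law. The masked value is thus uniform whatever \<open>w\<close> is, and
  so independent of \<open>f w\<close>, however \<open>f\<close> and \<open>g\<close> are
  related.\<close>

lemma map_pmf_one_time_pad:
  fixes g :: "'w \<Rightarrow> 'a::{finite, ab_group_add}"
  shows "map_pmf (\<lambda>(v, w). (f w, g w + v)) (pair_pmf (pmf_of_set UNIV) q) =
    pair_pmf (map_pmf f q) (pmf_of_set UNIV)"
proof -
  let ?U = "pmf_of_set (UNIV :: 'a set)"
  have shift: "map_pmf (\<lambda>v. c + v) ?U = ?U" for c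
    by (subst map_pmf_of_set_inj) (auto simp: inj_on_def)
  \<comment> \<open>The order of sampling is exchanged: with \<open>w\<close> drawn first, the
    translation is by a fixed element.\<close>
  have "map_pmf (\<lambda>(v, w). (f w, g w + v)) (pair_pmf ?U q) =
      bind_pmf q (\<lambda>w. map_pmf (Pair (f w)) (map_pmf (\<lambda>v. g w + v) ?U))"
    unfolding pair_pmf_def map_pmf_def
    by (subst bind_commute_pmf) (simp add: bind_assoc_pmf bind_return_pmf)
  also have "\<dots> = pair_pmf (map_pmf f q) ?U"
    unfolding shift by (simp add: pair_pmf_def map_pmf_def bind_assoc_pmf bind_return_pmf)
  finally show ?thesis .
qed

section \<open>Laws of random variables\<close>

definition has_law :: "'w measure \<Rightarrow> ('w \<Rightarrow> 'a) \<Rightarrow> 'a pmf \<Rightarrow> bool" where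
  "has_law M T p \<longleftrightarrow>
     T \<in> measurable M (count_space UNIV) \<and> distr M (count_space UNIV) T = measure_pmf p"

text \<open>Agreement is required on \<open>space M\<close> only, since this is where the constant
  variable of the helping user is known to be 0.\<close>

lemma has_law_comp:
  assumes "has_law M T p" and "\<And>\<omega>. \<omega> \<in> space M \<Longrightarrow> A \<omega> = f (T \<omega>)"
  shows "has_law M A (map_pmf f p)"
proof -
  have T [measurable]: "T \<in> measurable M (count_space UNIV)"
    and law: "measure_pmf p = distr M (count_space UNIV) T"
    using assms by (simp_all add: has_law_def)
  have "A \<in> measurable M (count_space UNIV) \<longleftrightarrow> (\<lambda>\<omega>. f (T \<omega>)) \<in> measurable M (count_space UNIV)"
    using assms(2) by (intro measurable_cong) auto
  moreover have "distr M (count_space UNIV) A = distr M (count_space UNIV) (\<lambda>\<omega>. f (T \<omega>))"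
    using assms(2) by (intro distr_cong) auto
  moreover have "distr M (count_space UNIV) (\<lambda>\<omega>. f (T \<omega>)) = measure_pmf (map_pmf f p)"
    by (simp add: map_pmf_rep_eq law distr_distr comp_def)
  moreover have "(\<lambda>\<omega>. f (T \<omega>)) \<in> measurable M (count_space UNIV)"
    by (rule measurable_compose[OF T]) simp
  ultimately show ?thesis
    by (simp add: has_law_def)
qed

lemma has_law_measure:
  assumes "has_law M T p"
  shows "measure M (T -` {t} \<inter> space M) = pmf p t"
proof -
  have "measure M (T -` {t} \<inter> space M) = measure (distr M (count_space UNIV) T) {t}"
    using assms by (subst measure_distr) (auto simp: has_law_def)
  then show ?thesis
    using assms unfolding has_law_def by (metis pmf.rep_eq)
qed

text \<open>The image may exceed the support by null values. The inclusion is enough to compare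
  library sums over the image with expectations, as the extra terms have weight 0.\<close>

lemma has_law_set_pmf:
  assumes "has_law M T p"
  shows "set_pmf p \<subseteq> T ` space M"
proof
  fix t assume "t \<in> set_pmf p"
  then have "measure M (T -` {t} \<inter> space M) \<noteq> 0"
    by (simp add: has_law_measure[OF assms] set_pmf_iff)
  then have "T -` {t} \<inter> space M \<noteq> {}"
    by (metis measure_empty)
  then show "t \<in> T ` space M"
    by auto
qed

lemma has_law_simple_distributed:
  assumes "prob_space M" and "has_law M T p" and "finite (T ` space M)"
  shows "simple_distributed M T (pmf p)"
proof (rule prob_space.simple_distributedI[OF assms(1)])
  show "simple_function M T"
    using assms(2,3)
    by (auto simp: simple_function_def has_law_def intro!: measurable_sets[where A = "count_space UNIV"])
qed (simp_all add: has_law_measure[OF assms(2)])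

lemma simple_distributed_comp:
  assumes "prob_space M" and T: "has_law M T p" and "finite (T ` space M)"
    and D: "\<And>\<omega>. \<omega> \<in> space M \<Longrightarrow> D \<omega> = k (T \<omega>)"
  shows "simple_distributed M D (pmf (map_pmf k p))"
proof (rule has_law_simple_distributed[OF assms(1) has_law_comp[OF T, where A = D and f = k]])
  have "D ` space M = k ` T ` space M"
    using D by (auto simp: image_image)
  then show "finite (D ` space M)"
    using assms(3) by simp
qed (fact D)

section \<open>Library informations in terms of one joint law\<close>

lemma CMI_eq_pmf_cmi:
  assumes M: "prob_space M" and b: "1 < b"
    and T: "has_law M T p" and fin: "finite (T ` space M)"
    and A: "\<And>\<omega>. \<omega> \<in> space M \<Longrightarrow> A \<omega> = f (T \<omega>)"
    and B: "\<And>\<omega>. \<omega> \<in> space M \<Longrightarrow> B \<omega> = g (T \<omega>)"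
    and C: "\<And>\<omega>. \<omega> \<in> space M \<Longrightarrow> C \<omega> = h (T \<omega>)"
  shows "CMI b M A B C = pmf_cmi b p f g h"
proof -
  interpret information_space M b
    using M b by (simp add: information_space_def information_space_axioms_def)
  have finp: "finite (set_pmf p)"
    using has_law_set_pmf[OF T] fin finite_subset by blast
  note sd = simple_distributed_comp[OF M T fin]
  have law: "has_law M (\<lambda>\<omega>. (A \<omega>, B \<omega>, C \<omega>)) (map_pmf (\<lambda>t. (f t, g t, h t)) p)"
    using A B C by (intro has_law_comp[OF T]) auto
  have finABC: "finite ((\<lambda>\<omega>. (A \<omega>, B \<omega>, C \<omega>)) ` space M)"
    by (rule simple_distributed_finite[OF sd[of _ "\<lambda>t. (f t, g t, h t)"]]) (use A B C in auto)
  let ?L = "\<lambda>(x, y, z). log b (pmf (map_pmf (\<lambda>t. (f t, g t, h t)) p) (x, y, z) /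
       (pmf (map_pmf (\<lambda>t. (f t, h t)) p) (x, z) *
         (pmf (map_pmf (\<lambda>t. (g t, h t)) p) (y, z) / pmf (map_pmf h p) z)))"
  have "CMI b M A B C = (\<Sum>t\<in>(\<lambda>\<omega>. (A \<omega>, B \<omega>, C \<omega>)) ` space M.
      ?L t * pmf (map_pmf (\<lambda>t. (f t, g t, h t)) p) t)"
    by (subst conditional_mutual_information_eq[OF sd[of _ h] sd[of _ "\<lambda>t. (g t, h t)"]
          sd[of _ "\<lambda>t. (f t, h t)"] sd[of _ "\<lambda>t. (f t, g t, h t)"]])
      (auto simp: A B C intro!: sum.cong)
  also have "\<dots> = measure_pmf.expectation (map_pmf (\<lambda>t. (f t, g t, h t)) p) ?L"
    using has_law_set_pmf[OF law] finABC by (intro integral_measure_pmf_real[symmetric]) auto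
  also have "\<dots> = pmf_cmi b p f g h"
    by (simp add: pmf_cmi_eq_expectation[OF finp b])
  finally show ?thesis .
qed

lemma MI_eq_pmf_entropy:
  assumes M: "prob_space M" and b: "1 < b"
    and T: "has_law M T p" and fin: "finite (T ` space M)"
    and A: "\<And>\<omega>. \<omega> \<in> space M \<Longrightarrow> A \<omega> = f (T \<omega>)"
    and B: "\<And>\<omega>. \<omega> \<in> space M \<Longrightarrow> B \<omega> = g (T \<omega>)"
  shows "MI b M A B = pmf_entropy b (map_pmf f p) + pmf_entropy b (map_pmf g p)
    - pmf_entropy b (map_pmf (\<lambda>t. (f t, g t)) p)"
proof -
  interpret information_space M b
    using M b by (simp add: information_space_def information_space_axioms_def)
  have finp: "finite (set_pmf p)"
    using has_law_set_pmf[OF T] fin finite_subset by blast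
  have int: "integrable (measure_pmf p) k" for k :: "_ \<Rightarrow> real"
    using finp by (intro integrable_measure_pmf_finite) auto
  note sd = simple_distributed_comp[OF M T fin]
  let ?fg = "\<lambda>t. (f t, g t)"
  have law: "has_law M (\<lambda>\<omega>. (A \<omega>, B \<omega>)) (map_pmf ?fg p)"
    using A B by (intro has_law_comp[OF T]) auto
  have finAB: "finite ((\<lambda>\<omega>. (A \<omega>, B \<omega>)) ` space M)"
    by (rule simple_distributed_finite[OF sd[of _ ?fg]]) (use A B in auto)
  let ?L = "\<lambda>(x, y). log b (pmf (map_pmf ?fg p) (x, y) / (pmf (map_pmf f p) x * pmf (map_pmf g p) y))"
  have "MI b M A B = (\<Sum>t\<in>(\<lambda>\<omega>. (A \<omega>, B \<omega>)) ` space M. ?L t * pmf (map_pmf ?fg p) t)"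
    by (subst mutual_information_simple_distributed[OF sd[of _ f] sd[of _ g] sd[of _ ?fg]])
      (auto simp: A B intro!: sum.cong)
  also have "\<dots> = measure_pmf.expectation (map_pmf ?fg p) ?L"
    using has_law_set_pmf[OF law] finAB by (intro integral_measure_pmf_real[symmetric]) auto
  also have "\<dots> = measure_pmf.expectation p (\<lambda>t. log b (pmf (map_pmf ?fg p) (f t, g t))
      - log b (pmf (map_pmf f p) (f t)) - log b (pmf (map_pmf g p) (g t)))"
    unfolding integral_map_pmf
  proof (intro integral_cong_AE)
    show "AE t in measure_pmf p. ?L (f t, g t) = log b (pmf (map_pmf ?fg p) (f t, g t))
      - log b (pmf (map_pmf f p) (f t)) - log b (pmf (map_pmf g p) (g t))"
      unfolding AE_measure_pmf_iff
    proof
      fix t assume t: "t \<in> set_pmf p"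
      show "?L (f t, g t) = log b (pmf (map_pmf ?fg p) (f t, g t))
        - log b (pmf (map_pmf f p) (f t)) - log b (pmf (map_pmf g p) (g t))"
        using pmf_map_pos[OF t, of f] pmf_map_pos[OF t, of g] pmf_map_pos[OF t, of ?fg] b
        by (simp add: log_divide_pos log_mult_pos)
    qed
  qed simp_all
  finally show ?thesis
    by (simp add: pmf_entropy_map int)
qed

text \<open>Quotient form and cross-multiplied form agree even for a null value of \<open>C\<close>:
  division by 0 gives 0 on one side, and on the other \<open>f0\<close> makes the product
  vanish.\<close>

lemma cond_indep_rv_iff_pmf_cond_indep:
  assumes T: "has_law M T p"
    and A: "\<And>\<omega>. \<omega> \<in> space M \<Longrightarrow> A \<omega> = f (T \<omega>)"
    and B: "\<And>\<omega>. \<omega> \<in> space M \<Longrightarrow> B \<omega> = g (T \<omega>)"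
    and C: "\<And>\<omega>. \<omega> \<in> space M \<Longrightarrow> C \<omega> = h (T \<omega>)"
  shows "cond_indep_rv M A B C \<longleftrightarrow> pmf_cond_indep p f g h"
proof -
  have m: "measure M {\<omega> \<in> space M. D \<omega> = x} = pmf (map_pmf k p) x"
    if "\<And>\<omega>. \<omega> \<in> space M \<Longrightarrow> D \<omega> = k (T \<omega>)" for D k x
    using has_law_measure[OF has_law_comp[OF T, where A = D and f = k, OF that], of x] by (simp add: vimage_def Int_def conj_commute)
  have hz: "measure M {\<omega> \<in> space M. C \<omega> = z} = pmf (map_pmf h p) z" for z
    by (rule m) (simp add: C)
  have fz: "measure M {\<omega> \<in> space M. A \<omega> = x \<and> C \<omega> = z} = pmf (map_pmf (\<lambda>t. (f t, h t)) p) (x, z)" for x z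
    using m[of "\<lambda>\<omega>. (A \<omega>, C \<omega>)" "\<lambda>t. (f t, h t)" "(x, z)"] A C by simp
  have gz: "measure M {\<omega> \<in> space M. B \<omega> = y \<and> C \<omega> = z} = pmf (map_pmf (\<lambda>t. (g t, h t)) p) (y, z)" for y z
    using m[of "\<lambda>\<omega>. (B \<omega>, C \<omega>)" "\<lambda>t. (g t, h t)" "(y, z)"] B C by simp
  have fgz: "measure M {\<omega> \<in> space M. A \<omega> = x \<and> B \<omega> = y \<and> C \<omega> = z} =
      pmf (map_pmf (\<lambda>t. (f t, g t, h t)) p) (x, y, z)" for x y z
    using m[of "\<lambda>\<omega>. (A \<omega>, B \<omega>, C \<omega>)" "\<lambda>t. (f t, g t, h t)" "(x, y, z)"] A B C
    by simp
  have f0: "pmf (map_pmf (\<lambda>t. (f t, h t)) p) (x, z) = 0" if "pmf (map_pmf h p) z = 0" for x z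
    by (rule pmf_map_comp_zero[where k = snd and h = h]) (use that in auto)
  have "(u / r = v / r * (w / r)) \<longleftrightarrow> u * r = v * w" if "r = 0 \<Longrightarrow> v = 0" for u v w r :: real
    using that by (cases "r = 0") (auto simp: field_simps)
  then show ?thesis
    by (simp add: cond_indep_rv_def pmf_cond_indep_def cond_prob_def hz fz gz fgz f0)
qed

lemma has_lawI:
  fixes T :: "'w \<Rightarrow> 'a::finite"
  assumes "T \<in> measurable M (count_space UNIV)" and "\<And>t. measure M (T -` {t} \<inter> space M) = pmf p t"
    and "prob_space M"
  shows "has_law M T p"
proof -
  interpret prob_space M by fact
  have "distr M (count_space UNIV) T = measure_pmf p"
  proof (rule measure_eqI_finite[where A = UNIV])
    fix t :: 'a
    show "emeasure (distr M (count_space UNIV) T) {t} = emeasure (measure_pmf p) {t}"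
      using assms by (simp add: emeasure_distr emeasure_eq_measure emeasure_pmf_single)
  qed simp_all
  then show ?thesis
    using assms by (simp add: has_law_def)
qed

lemma has_law_exists:
  fixes T :: "'w \<Rightarrow> 'a::finite"
  assumes "T \<in> measurable M (count_space UNIV)" and "prob_space M"
  obtains p where "has_law M T p"
proof -
  interpret prob_space M by fact
  let ?f = "\<lambda>t. measure M (T -` {t} \<inter> space M)"
  have ev: "T -` {t} \<inter> space M \<in> events" for t
    using assms(1) by (rule measurable_sets) simp
  have "(\<Sum>t\<in>UNIV. ?f t) = measure M (\<Union>t. T -` {t} \<inter> space M)"
    by (intro finite_measure_finite_Union[symmetric]) (use ev in \<open>auto simp: disjoint_family_on_def\<close>)
  also have "(\<Union>t. T -` {t} \<inter> space M) = space M"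
    by auto
  finally have "(\<Sum>t\<in>UNIV. ?f t) = 1"
    by (simp add: prob_space)
  then have "(\<integral>\<^sup>+t. ennreal (?f t) \<partial>count_space UNIV) = 1"
    by (simp add: nn_integral_count_space_finite)
  then have "pmf (embed_pmf ?f) t = ?f t" for t
    by (intro pmf_embed_pmf) auto
  then have "has_law M T (embed_pmf ?f)"
    using assms by (intro has_lawI) auto
  then show ?thesis
    by (rule that)
qed

section \<open>Independence of three variables\<close>

lemma rv_events_comp: "rv_events M (\<lambda>\<omega>. k (D \<omega>)) \<subseteq> rv_events M D"
proof -
  have "(\<lambda>\<omega>. k (D \<omega>)) -` S = D -` (k -` S)" for S
    by auto
  then show ?thesis
    by (auto simp: rv_events_def)
qed

text \<open>A function of a variable generates fewer events, and independence passes to smaller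
  families.\<close>

lemma indep_triple_comp:
  assumes "prob_space M" "indep_triple M A B C"
  shows "indep_triple M (\<lambda>\<omega>. f (A \<omega>)) (\<lambda>\<omega>. g (B \<omega>)) (\<lambda>\<omega>. h (C \<omega>))"
  using assms(2) unfolding indep_triple_def
  by (rule prob_space.indep_sets_mono_sets[OF assms(1)])
    (auto dest: subsetD[OF rv_events_comp])

lemma indep_triple_measurable:
  assumes "prob_space M" "indep_triple M A B C"
  shows "A \<in> measurable M (count_space UNIV)" "B \<in> measurable M (count_space UNIV)"
    "C \<in> measurable M (count_space UNIV)"
proof -
  have "rv_events M A \<subseteq> sets M" "rv_events M B \<subseteq> sets M" "rv_events M C \<subseteq> sets M"
    using assms(2)
    by (auto simp: indep_triple_def prob_space.indep_sets_def[OF assms(1)] numeral_2_eq_2)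
  then show "A \<in> measurable M (count_space UNIV)" "B \<in> measurable M (count_space UNIV)"
    "C \<in> measurable M (count_space UNIV)"
    by (auto simp: rv_events_def intro!: measurableI)
qed

text \<open>On finite types the joint law is determined by its point masses, so the product rule is
  applied to the three point events, with the full index set.\<close>

lemma indep_triple_has_law:
  fixes A :: "'w \<Rightarrow> 'a::finite" and B :: "'w \<Rightarrow> 'b::finite" and C :: "'w \<Rightarrow> 'c::finite"
  assumes M: "prob_space M" and ind: "indep_triple M A B C"
    and laws: "has_law M A p" "has_law M B q" "has_law M C r"
  shows "has_law M (\<lambda>\<omega>. (A \<omega>, B \<omega>, C \<omega>)) (pair_pmf p (pair_pmf q r))"
proof (rule has_lawI[OF _ _ M])
  interpret prob_space M by fact
  note [measurable] = indep_triple_measurable[OF M ind]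
  have "(\<lambda>\<omega>. (A \<omega>, B \<omega>, C \<omega>)) \<in> measurable M (count_space UNIV \<Otimes>\<^sub>M count_space UNIV \<Otimes>\<^sub>M count_space UNIV)"
    by measurable
  then show "(\<lambda>\<omega>. (A \<omega>, B \<omega>, C \<omega>)) \<in> measurable M (count_space UNIV)"
    by (simp add: pair_measure_count_space)
  fix t :: "'a \<times> 'b \<times> 'c"
  obtain a b c where t: "t = (a, b, c)"
    by (cases t)
  define E where "E i = [A -` {a} \<inter> space M, B -` {b} \<inter> space M, C -` {c} \<inter> space M] ! i" for i
  have "prob (\<Inter>i\<in>{0, 1, 2}. E i) = (\<Prod>i\<in>{0, 1, 2}. prob (E i))"
    using ind unfolding indep_triple_def
    by (rule indep_setsD) (auto simp: E_def rv_events_def)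
  moreover have "(\<lambda>\<omega>. (A \<omega>, B \<omega>, C \<omega>)) -` {t} \<inter> space M = (\<Inter>i\<in>{0, 1, 2}. E i)"
    by (auto simp: E_def t)
  ultimately have "measure M ((\<lambda>\<omega>. (A \<omega>, B \<omega>, C \<omega>)) -` {t} \<inter> space M) = (\<Prod>i\<in>{0, 1, 2}. prob (E i))"
    by simp
  also have "\<dots> = pmf p a * (pmf q b * pmf r c)"
    by (simp add: E_def has_law_measure[OF laws(1)] has_law_measure[OF laws(2)] has_law_measure[OF laws(3)])
  finally show "measure M ((\<lambda>\<omega>. (A \<omega>, B \<omega>, C \<omega>)) -` {t} \<inter> space M) = pmf (pair_pmf p (pair_pmf q r)) t"
    by (simp add: pmf_pair t)
qed

section \<open>The two-way wiretap channel\<close>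

lemma sender_law:
  fixes V Y' :: "'w \<Rightarrow> 'y::{finite,field}" and X' :: "'w \<Rightarrow> 'x::{finite,field}"
  assumes "sender_aux M V X' Y'" "has_law M (\<lambda>\<omega>. (V \<omega>, X' \<omega>, Y' \<omega>)) p"
  shows "p = map_pmf (\<lambda>v. (v, 0, v)) (pmf_of_set UNIV)"
proof (rule pmf_eqI)
  fix t :: "'y \<times> 'x \<times> 'y"
  obtain v x y where t: "t = (v, x, y)"
    by (cases t)
  have "pmf p t = measure M {\<omega> \<in> space M. X' \<omega> = x \<and> Y' \<omega> = y \<and> V \<omega> = v}"
    unfolding has_law_measure[OF assms(2), symmetric]
    by (rule arg_cong[where f = "measure M"]) (auto simp: t)
  also have "\<dots> = 1 / real CARD('y) * of_bool (x = 0) * of_bool (y = v)"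
    using assms(1) by (simp add: sender_aux_def)
  also have "\<dots> = pmf (map_pmf (\<lambda>v. (v, 0, v)) (pmf_of_set UNIV)) t"
  proof (cases "x = 0 \<and> y = v")
    case True
    have "pmf (map_pmf (\<lambda>v. (v, 0::'x, v)) (pmf_of_set UNIV)) (v, 0, v) = pmf (pmf_of_set UNIV) v"
      by (rule pmf_map_inj') (auto simp: inj_def)
    then show ?thesis
      using True by (simp add: t)
  next
    case False
    then have "pmf (map_pmf (\<lambda>v. (v, 0, v)) (pmf_of_set UNIV)) t = 0"
      by (auto simp: t pmf_eq_0_set_pmf)
    then show ?thesis
      using False by auto
  qed
  finally show "pmf p t = pmf (map_pmf (\<lambda>v. (v, 0, v)) (pmf_of_set UNIV)) t" .
qed

text \<open>As \<open>V\<close> is 0 on all of \<open>space M\<close>, the conditioning event has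
  probability 1 and the conditional law is the unconditional one.\<close>

lemma helper_law:
  fixes X' :: "'w \<Rightarrow> 'x::{finite,field}" and Y' :: "'w \<Rightarrow> 'y::{finite,field}"
  assumes M: "prob_space M" and "helper_aux M V X' Y'" "has_law M (\<lambda>\<omega>. (X' \<omega>, Y' \<omega>)) p"
  shows "p = pmf_of_set UNIV"
proof (rule pmf_eqI)
  fix t :: "'x \<times> 'y"
  obtain x y where t: "t = (x, y)"
    by (cases t)
  have V: "V \<omega> = 0" if "\<omega> \<in> space M" for \<omega>
    using assms(2) that by (auto simp: helper_aux_def)
  have "1 / (real CARD('x) * real CARD('y)) = \<P>(\<omega> in M. X' \<omega> = x \<and> Y' \<omega> = y \<bar> V \<omega> = 0)"
    using assms(2) by (simp add: helper_aux_def)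
  also have "\<dots> = measure M {\<omega> \<in> space M. X' \<omega> = x \<and> Y' \<omega> = y} / measure M (space M)"
    unfolding cond_prob_def
    by (intro arg_cong2[where f = "(/)"] arg_cong[where f = "measure M"]) (auto simp: V)
  also have "\<dots> = measure M {\<omega> \<in> space M. X' \<omega> = x \<and> Y' \<omega> = y}"
    by (simp add: prob_space.prob_space[OF M])
  also have "\<dots> = pmf p t"
    unfolding has_law_measure[OF assms(3), symmetric]
    by (rule arg_cong[where f = "measure M"]) (auto simp: t)
  finally show "pmf p t = pmf (pmf_of_set UNIV) t"
    by simp
qed

lemma channel_use_law:
  fixes W :: "('x1::finite, 'x2::finite, 'y1::finite, 'y2::finite, 'z::finite) two_way_channel"
  assumes M: "prob_space M" and W: "channel_use M W P1 P2 X1 X2 Y1 Y2 Z"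
  obtains p where "has_law M (\<lambda>\<omega>. (X1 \<omega>, X2 \<omega>, Y1 \<omega>, Y2 \<omega>, Z \<omega>)) p"
    and "\<And>x1 x2 y1 y2 z. pmf p (x1, x2, y1, y2, z) = pmf P1 x1 * pmf P2 x2 * pmf (W x1 x2) (y1, y2, z)"
proof -
  obtain p where p: "has_law M (\<lambda>\<omega>. (X1 \<omega>, X2 \<omega>, Y1 \<omega>, Y2 \<omega>, Z \<omega>)) p"
    using has_law_exists[OF _ M] W unfolding channel_use_def by blast
  have "pmf p (x1, x2, y1, y2, z) = pmf P1 x1 * pmf P2 x2 * pmf (W x1 x2) (y1, y2, z)"
    for x1 x2 y1 y2 z
  proof -
    have "pmf p (x1, x2, y1, y2, z) =
        \<P>(\<omega> in M. X1 \<omega> = x1 \<and> X2 \<omega> = x2 \<and> Y1 \<omega> = y1 \<and> Y2 \<omega> = y2 \<and> Z \<omega> = z)"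
      unfolding has_law_measure[OF p, symmetric]
      by (rule arg_cong[where f = "measure M"]) auto
    then show ?thesis
      using W by (simp add: channel_use_def)
  qed
  with p show ?thesis
    by (rule that)
qed

text \<open>The joint mass is an input factor times one factor per output. Summing out the output
  that is not mentioned leaves the product form required by \<open>pmf_cond_indepI\<close>. The
  third claim serves the case where User 2 is the sender.\<close>

lemma
  fixes W :: "('x1::finite, 'x2::finite, 'y1::finite, 'y2::finite, 'z::finite) two_way_channel"
  assumes W: "cond_indep_channel W"
    and p: "\<And>x1 x2 y1 y2 z. pmf p (x1, x2, y1, y2, z) = pmf P1 x1 * pmf P2 x2 * pmf (W x1 x2) (y1, y2, z)"
  shows channel_cond_indep_outputs:
      "pmf_cond_indep p (\<lambda>(x1, x2, y1, y2, z). y1) (\<lambda>(x1, x2, y1, y2, z). y2)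
      (\<lambda>(x1, x2, y1, y2, z). (x1, x2))" (is "pmf_cond_indep p ?Y1 ?Y2 ?X")
    and channel_cond_indep_1:
      "pmf_cond_indep p (\<lambda>(x1, x2, y1, y2, z). y1) (\<lambda>(x1, x2, y1, y2, z). z)
      (\<lambda>(x1, x2, y1, y2, z). (x1, x2))" (is "pmf_cond_indep p ?Y1 ?Z ?X")
    and channel_cond_indep_2:
      "pmf_cond_indep p (\<lambda>(x1, x2, y1, y2, z). y2) (\<lambda>(x1, x2, y1, y2, z). z)
      (\<lambda>(x1, x2, y1, y2, z). (x1, x2))"
proof -
  let ?A = "\<lambda>x. map_pmf (\<lambda>(y1, y2, z). y1) (case_prod W x)"
  let ?B = "\<lambda>x. map_pmf (\<lambda>(y1, y2, z). y2) (case_prod W x)"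
  let ?C = "\<lambda>x. map_pmf (\<lambda>(y1, y2, z). z) (case_prod W x)"
  let ?K = "\<lambda>x. pmf P1 (fst x) * pmf P2 (snd x)"
  have A: "sum (pmf (?A x)) UNIV = 1" and B: "sum (pmf (?B x)) UNIV = 1"
    and C: "sum (pmf (?C x)) UNIV = 1" for x
    by (auto intro!: sum_pmf_eq_1)
  \<comment> \<open>An injective rearrangement keeps point masses; it brings the output to be summed
    out to the front.\<close>
  have perm: "pmf (map_pmf \<sigma> p) (\<sigma> t) = (case t of (x1, x2, y1, y2, z) \<Rightarrow>
      ?K (x1, x2) * pmf (?A (x1, x2)) y1 * pmf (?B (x1, x2)) y2 * pmf (?C (x1, x2)) z)"
    if "inj \<sigma>" for \<sigma> :: "_ \<Rightarrow> 'v" and t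
    using W p by (cases t) (simp add: pmf_map_inj'[OF that] cond_indep_channel_def)
  show "pmf_cond_indep p ?Y1 ?Y2 ?X"
  proof (rule pmf_cond_indepI[where k = ?K and A = ?A and B = ?B])
    fix y1 y2 x
    show "pmf (map_pmf (\<lambda>t. (?Y1 t, ?Y2 t, ?X t)) p) (y1, y2, x) = ?K x * pmf (?A x) y1 * pmf (?B x) y2"
      using perm[of "\<lambda>t. (?Z t, ?Y1 t, ?Y2 t, ?X t)" "(fst x, snd x, y1, y2, _)"] C[of x]
      by (subst sum_pmf_map_Pair[where f = ?Z, symmetric])
        (auto simp: inj_def case_prod_unfold simp flip: sum_distrib_left)
  qed
  show "pmf_cond_indep p ?Y1 ?Z ?X"
  proof (rule pmf_cond_indepI[where k = ?K and A = ?A and B = ?C])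
    fix y1 z x
    show "pmf (map_pmf (\<lambda>t. (?Y1 t, ?Z t, ?X t)) p) (y1, z, x) = ?K x * pmf (?A x) y1 * pmf (?C x) z"
      using perm[of "\<lambda>t. (?Y2 t, ?Y1 t, ?Z t, ?X t)" "(fst x, snd x, y1, _, z)"] B[of x]
      by (subst sum_pmf_map_Pair[where f = ?Y2, symmetric])
        (auto simp: inj_def case_prod_unfold simp flip: sum_distrib_left sum_distrib_right)
  qed
  show "pmf_cond_indep p ?Y2 ?Z ?X"
  proof (rule pmf_cond_indepI[where k = ?K and A = ?B and B = ?C])
    fix y2 z x
    show "pmf (map_pmf (\<lambda>t. (?Y2 t, ?Z t, ?X t)) p) (y2, z, x) = ?K x * pmf (?B x) y2 * pmf (?C x) z"
      using perm[of "\<lambda>t. (?Y1 t, ?Y2 t, ?Z t, ?X t)" "(fst x, snd x, _, y2, z)"] A[of x]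
      by (subst sum_pmf_map_Pair[where f = ?Y1, symmetric])
        (auto simp: inj_def case_prod_unfold simp flip: sum_distrib_left sum_distrib_right)
  qed
qed

section \<open>Rates when one user sends\<close>

text \<open>The channel enters through two conditional independences of the law \<open>r\<close>,
  and the inputs and outputs appear by position. Exchanging the users then amounts to permuting the
  components of \<open>r\<close>.\<close>

lemma one_sided_rates:
  fixes M :: "'w measure" and b :: real
    and r :: "('x1::{finite,field} \<times> 'x2::{finite,field} \<times> 'y1::{finite,field} \<times> 'y2::{finite,field} \<times> 'z::finite) pmf"
    and X1 X1' :: "'w \<Rightarrow> 'x1" and X2 X2' :: "'w \<Rightarrow> 'x2"
    and V1 Y1 Y1' :: "'w \<Rightarrow> 'y1" and Y2 Y2' :: "'w \<Rightarrow> 'y2" and Z :: "'w \<Rightarrow> 'z" and V2 :: "'w \<Rightarrow> nat"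
  assumes M: "prob_space M" and b: "1 < b"
    and law: "has_law M (\<lambda>\<omega>. ((V1 \<omega>, X1' \<omega>, Y1' \<omega>), (X2' \<omega>, Y2' \<omega>), (X1 \<omega>, X2 \<omega>, Y1 \<omega>, Y2 \<omega>, Z \<omega>)))
      (pair_pmf (map_pmf (\<lambda>v. (v, 0, v)) (pmf_of_set UNIV)) (pair_pmf (pmf_of_set UNIV) r))"
      (is "has_law M ?T _")
    and V2: "V2 \<in> space M \<rightarrow> {0}"
    and ci_y: "pmf_cond_indep r (\<lambda>(x1, x2, y1, y2, z). y1) (\<lambda>(x1, x2, y1, y2, z). y2)
      (\<lambda>(x1, x2, y1, y2, z). (x1, x2))"
    and ci_z: "pmf_cond_indep r (\<lambda>(x1, x2, y1, y2, z). y1) (\<lambda>(x1, x2, y1, y2, z). z)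
      (\<lambda>(x1, x2, y1, y2, z). (x1, x2))"
  shows "CMI b M V1 (\<lambda>\<omega>. (X2 \<omega>, Y2 \<omega>, (X1 \<oplus> X1') \<omega>, (Y1 \<oplus> Y1') \<omega>)) (\<lambda>\<omega>. (X2' \<omega>, Y2' \<omega>))
          - MI b M (\<lambda>\<omega>. (V1 \<omega>, V2 \<omega>))
              (\<lambda>\<omega>. (Z \<omega>, (X1 \<oplus> X1') \<omega>, (Y1 \<oplus> Y1') \<omega>, (X2 \<oplus> X2') \<omega>, (Y2 \<oplus> Y2') \<omega>))
          = CMI b M Y1 X2 X1 - CMI b M Y1 Z X1 \<and>
        CMI b M Y1 X2 X1 - CMI b M Y1 Z X1 \<ge> 0 \<and>
        (CMI b M Y1 X2 X1 - CMI b M Y1 Z X1 > 0 \<longleftrightarrow>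
           \<not> cond_indep_rv M Y1 X2 (\<lambda>\<omega>. (X1 \<omega>, Z \<omega>))) \<and>
        CMI b M V2 (\<lambda>\<omega>. (X1 \<omega>, Y1 \<omega>, (X2 \<oplus> X2') \<omega>, (Y2 \<oplus> Y2') \<omega>)) (\<lambda>\<omega>. (X1' \<omega>, Y1' \<omega>)) = 0"
proof -
  define uv where "uv = pmf_of_set (UNIV :: 'y1 set)"
  define uu where "uu = pmf_of_set (UNIV :: ('x2 \<times> 'y2) set)"
  define p where "p = pair_pmf uv (pair_pmf uu r)"
  define E :: "'y1 \<times> ('x2 \<times> 'y2) \<times> 'x1 \<times> 'x2 \<times> 'y1 \<times> 'y2 \<times> 'z \<Rightarrow>
      ('y1 \<times> 'x1 \<times> 'y1) \<times> ('x2 \<times> 'y2) \<times> 'x1 \<times> 'x2 \<times> 'y1 \<times> 'y2 \<times> 'z"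
    where "E = (\<lambda>(v, u, w). ((v, 0, v), u, w))"
  \<comment> \<open>The law of \<open>?T\<close> becomes the image under \<open>E\<close> of three
    independent sources, so all entropies are computed over the product law
    \<open>p\<close>.\<close>
  have "pair_pmf (map_pmf (\<lambda>v. (v, 0, v)) (pmf_of_set UNIV)) (pair_pmf (pmf_of_set UNIV) r) = map_pmf E p"
    by (simp add: pair_map_pmf1 p_def uv_def uu_def E_def apfst_def map_prod_def case_prod_unfold)
  then have T: "has_law M ?T (map_pmf E p)"
    using law by simp
  have fin: "finite (?T ` space M)"
    by simp
  have V2_0: "V2 \<omega> = 0" if "\<omega> \<in> space M" for \<omega>
    using V2 that by auto
  note cmi = CMI_eq_pmf_cmi[OF M b T fin]
  let ?H = "\<lambda>f. pmf_entropy b (map_pmf f p)"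
  let ?K = "\<lambda>k. pmf_entropy b (map_pmf k r)"
  have rp: "r = map_pmf (\<lambda>(v, u, w). w) p"
  proof -
    have "map_pmf (\<lambda>(v, u, w). w) p = map_pmf snd (map_pmf snd p)"
      by (simp add: map_pmf_comp case_prod_unfold)
    then show ?thesis
      by (simp add: p_def map_snd_pair_pmf)
  qed
  define x1 where "x1 = (\<lambda>(x1 :: 'x1, x2 :: 'x2, y1 :: 'y1, y2 :: 'y2, z :: 'z). x1)"
  define x2 where "x2 = (\<lambda>(x1 :: 'x1, x2 :: 'x2, y1 :: 'y1, y2 :: 'y2, z :: 'z). x2)"
  define y1 where "y1 = (\<lambda>(x1 :: 'x1, x2 :: 'x2, y1 :: 'y1, y2 :: 'y2, z :: 'z). y1)"
  define y2 where "y2 = (\<lambda>(x1 :: 'x1, x2 :: 'x2, y1 :: 'y1, y2 :: 'y2, z :: 'z). y2)"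
  define z where "z = (\<lambda>(x1 :: 'x1, x2 :: 'x2, y1 :: 'y1, y2 :: 'y2, z :: 'z). z)"
  note proj = x1_def x2_def y1_def y2_def z_def
  let ?hv = "pmf_entropy b uv" and ?hu = "pmf_entropy b uu"
  \<comment> \<open>Almost surely \<open>X1' = 0\<close> and \<open>v = V1 = Y1'\<close>, so every variable is a function of the independent
    \<open>v\<close>, \<open>u = (X2', Y2')\<close> and the channel variables \<open>w\<close>.\<close>
  have pad: "map_pmf (\<lambda>(v, u, w). (f u w, y1 w + v)) p =
      pair_pmf (map_pmf (\<lambda>(u, w). f u w) (pair_pmf uu r)) uv" for f :: "_ \<Rightarrow> _ \<Rightarrow> 't"
    using map_pmf_one_time_pad[of "\<lambda>(u, w). f u w" "\<lambda>(u, w). y1 w" "pair_pmf uu r"]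
    by (simp add: p_def uv_def case_prod_unfold)
  \<comment> \<open>The two masks of User 2 act as a single pad in the product group
    \<open>'x2 \<times> 'y2\<close>, with componentwise addition.\<close>
  have pad2: "map_pmf (\<lambda>(u, w). (f w, (x2 w, y2 w) + u)) (pair_pmf uu r) = pair_pmf (map_pmf f r) uu"
    for f :: "_ \<Rightarrow> 't"
    unfolding uu_def by (rule map_pmf_one_time_pad)
  have H_v: "?H (\<lambda>(v, u, w). v) = ?hv"
    by (simp add: p_def case_prod_unfold map_fst_pair_pmf)
  have H_u: "?H (\<lambda>(v, u, w). u) = ?hu"
  proof -
    have "map_pmf (\<lambda>(v, u, w). u) p = map_pmf fst (map_pmf snd p)"
      by (simp add: map_pmf_comp case_prod_unfold)
    then show ?thesis
      by (simp add: p_def map_fst_pair_pmf map_snd_pair_pmf)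
  qed
  have H_vuw: "?H (\<lambda>(v, u, w). (v, u, f w)) = ?hv + ?hu + ?K f" for f :: "_ \<Rightarrow> 't"
  proof -
    have "map_pmf (\<lambda>(v, u, w). (v, u, f w)) p = pair_pmf uv (pair_pmf uu (map_pmf f r))"
      by (simp add: p_def pair_map_pmf2 apsnd_def map_prod_def case_prod_unfold map_pmf_comp)
    then show ?thesis
      using b by (simp add: pmf_entropy_pair)
  qed
  have H_vu: "?H (\<lambda>(v, u, w). (v, u)) = ?hv + ?hu"
  proof -
    have "?H (\<lambda>(v, u, w). (v, u)) = ?H (\<lambda>(v, u, w). (v, u, ()))"
      by (rule pmf_entropy_map_cong) auto
    then show ?thesis
      using H_vuw[of "\<lambda>_. ()"] by (simp add: pmf_entropy_return)
  qed
  have H_pad: "?H (\<lambda>(v, u, w). ((u, f w), y1 w + v)) = ?hu + ?K f + ?hv" for f :: "_ \<Rightarrow> 't"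
  proof -
    have "map_pmf (\<lambda>(u, w). (u, f w)) (pair_pmf uu r) = pair_pmf uu (map_pmf f r)"
      by (simp add: pair_map_pmf2 apsnd_def map_prod_def case_prod_unfold)
    then show ?thesis
      using b by (simp add: pad pmf_entropy_pair)
  qed
  have H_pad2: "?H (\<lambda>(v, u, w). ((f w, (x2 w, y2 w) + u), y1 w + v)) = ?K f + ?hu + ?hv" for f :: "_ \<Rightarrow> 't"
    using b by (simp add: pad pad2 pmf_entropy_pair)
  have H_pad3: "?H (\<lambda>(v, u, w). (v, f w, (x2 w, y2 w) + u)) = ?hv + ?K f + ?hu" for f :: "_ \<Rightarrow> 't"
  proof -
    have "map_pmf (\<lambda>(v, u, w). (v, f w, (x2 w, y2 w) + u)) p =
      pair_pmf uv (map_pmf (\<lambda>(u, w). (f w, (x2 w, y2 w) + u)) (pair_pmf uu r))"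
      by (simp add: p_def pair_map_pmf2 apsnd_def map_prod_def case_prod_unfold)
    then show ?thesis
      using b by (simp add: pad2 pmf_entropy_pair)
  qed
  have "CMI b M V1 (\<lambda>\<omega>. (X2 \<omega>, Y2 \<omega>, (X1 \<oplus> X1') \<omega>, (Y1 \<oplus> Y1') \<omega>)) (\<lambda>\<omega>. (X2' \<omega>, Y2' \<omega>)) =
     pmf_cmi b (map_pmf E p) (\<lambda>((v, x', y'), u, w). v)
       (\<lambda>((v, x', y'), u, w). (x2 w, y2 w, x1 w + x', y1 w + y')) (\<lambda>((v, x', y'), u, w). u)"
    by (rule cmi) (auto simp: proj)
  also have "\<dots> = ?hv + ?K (\<lambda>w. (x1 w, x2 w, y2 w)) - ?K (\<lambda>w. (x1 w, x2 w, y1 w, y2 w))"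
  proof -
    \<comment> \<open>Without \<open>v\<close>, the symbol \<open>y1 w + v\<close> is a fresh
      uniform one; the tuple is arranged so that \<open>H_pad\<close> applies.\<close>
    have 1: "?H (\<lambda>(v, u, w). ((x2 w, y2 w, x1 w, y1 w + v), u)) =
        ?H (\<lambda>(v, u, w). ((u, x1 w, x2 w, y2 w), y1 w + v))"
      by (rule pmf_entropy_map_cong) auto
    \<comment> \<open>Once \<open>v\<close> is among the components, \<open>y1 w + v\<close> and
      \<open>y1 w\<close> determine each other.\<close>
    have 2: "?H (\<lambda>(v, u, w). (v, (x2 w, y2 w, x1 w, y1 w + v), u)) =
        ?H (\<lambda>(v, u, w). (v, u, x1 w, x2 w, y1 w, y2 w))"
      by (rule pmf_entropy_map_cong) auto
    show ?thesis
      unfolding pmf_cmi_def map_pmf_comp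
      using H_vu H_u H_vuw[of "\<lambda>w. (x1 w, x2 w, y1 w, y2 w)"] H_pad[of "\<lambda>w. (x1 w, x2 w, y2 w)"] 1 2
      by (simp add: E_def case_prod_unfold)
  qed
  finally have main: "CMI b M V1 (\<lambda>\<omega>. (X2 \<omega>, Y2 \<omega>, (X1 \<oplus> X1') \<omega>, (Y1 \<oplus> Y1') \<omega>)) (\<lambda>\<omega>. (X2' \<omega>, Y2' \<omega>)) =
    ?hv + ?K (\<lambda>w. (x1 w, x2 w, y2 w)) - ?K (\<lambda>w. (x1 w, x2 w, y1 w, y2 w))" .
  have "MI b M (\<lambda>\<omega>. (V1 \<omega>, V2 \<omega>))
      (\<lambda>\<omega>. (Z \<omega>, (X1 \<oplus> X1') \<omega>, (Y1 \<oplus> Y1') \<omega>, (X2 \<oplus> X2') \<omega>, (Y2 \<oplus> Y2') \<omega>)) =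
    pmf_entropy b (map_pmf (\<lambda>((v, x', y'), u, w). (v, 0::nat)) (map_pmf E p)) +
    pmf_entropy b (map_pmf (\<lambda>((v, x', y'), u, w).
      (z w, x1 w + x', y1 w + y', x2 w + fst u, y2 w + snd u)) (map_pmf E p)) -
    pmf_entropy b (map_pmf (\<lambda>t. ((\<lambda>((v, x', y'), u, w). (v, 0::nat)) t, (\<lambda>((v, x', y'), u, w).
      (z w, x1 w + x', y1 w + y', x2 w + fst u, y2 w + snd u)) t)) (map_pmf E p))"
    by (rule MI_eq_pmf_entropy[OF M b T fin]) (auto simp: proj V2_0)
  also have "\<dots> = ?hv + ?K (\<lambda>w. (x1 w, z w)) - ?K (\<lambda>w. (x1 w, y1 w, z w))"
  proof -
    have 1: "?H (\<lambda>(v, u, w). (v, 0::nat)) = ?H (\<lambda>(v, u, w). v)"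
      by (rule pmf_entropy_map_cong) auto
    \<comment> \<open>Here \<open>u\<close> is not observed, so the masked \<open>x2\<close> and
      \<open>y2\<close> are noise and contribute only \<open>?hu\<close>. This term occurs with and
      without \<open>v\<close> and cancels.\<close>
    have 2: "?H (\<lambda>(v, u, w). (z w, x1 w, y1 w + v, x2 w + fst u, y2 w + snd u)) =
        ?H (\<lambda>(v, u, w). (((x1 w, z w), (x2 w, y2 w) + u), y1 w + v))"
      by (rule pmf_entropy_map_cong) auto
    have 3: "?H (\<lambda>(v, u, w). ((v, 0::nat), (z w, x1 w, y1 w + v, x2 w + fst u, y2 w + snd u))) =
        ?H (\<lambda>(v, u, w). (v, (x1 w, y1 w, z w), (x2 w, y2 w) + u))"
      by (rule pmf_entropy_map_cong) auto
    show ?thesis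
      unfolding map_pmf_comp
      using H_v H_pad2[of "\<lambda>w. (x1 w, z w)"] H_pad3[of "\<lambda>w. (x1 w, y1 w, z w)"] 1 2 3
      by (simp add: E_def case_prod_unfold)
  qed
  finally have leak: "MI b M (\<lambda>\<omega>. (V1 \<omega>, V2 \<omega>))
      (\<lambda>\<omega>. (Z \<omega>, (X1 \<oplus> X1') \<omega>, (Y1 \<oplus> Y1') \<omega>, (X2 \<oplus> X2') \<omega>, (Y2 \<oplus> Y2') \<omega>)) =
    ?hv + ?K (\<lambda>w. (x1 w, z w)) - ?K (\<lambda>w. (x1 w, y1 w, z w))" .
  have Tr: "has_law M (\<lambda>\<omega>. (X1 \<omega>, X2 \<omega>, Y1 \<omega>, Y2 \<omega>, Z \<omega>)) r"
  proof -
    have "map_pmf (\<lambda>(s, u, w). w) (map_pmf E p) = r"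
      unfolding rp map_pmf_comp by (simp add: E_def case_prod_unfold)
    moreover have "has_law M (\<lambda>\<omega>. (X1 \<omega>, X2 \<omega>, Y1 \<omega>, Y2 \<omega>, Z \<omega>))
        (map_pmf (\<lambda>(s, u, w). w) (map_pmf E p))"
      by (rule has_law_comp[OF T]) simp
    ultimately show ?thesis
      by simp
  qed
  note cmi_r = CMI_eq_pmf_cmi[OF M b Tr finite]
  have c_x: "CMI b M Y1 X2 X1 = pmf_cmi b r y1 x2 x1"
    by (rule cmi_r) (auto simp: proj)
  have c_z: "CMI b M Y1 Z X1 = pmf_cmi b r y1 z x1"
    by (rule cmi_r) (auto simp: proj)
  have iff: "cond_indep_rv M Y1 X2 (\<lambda>\<omega>. (X1 \<omega>, Z \<omega>)) \<longleftrightarrow> pmf_cond_indep r y1 x2 (\<lambda>w. (x1 w, z w))"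
    by (rule cond_indep_rv_iff_pmf_cond_indep[OF Tr]) (auto simp: proj)
  have "(\<lambda>(x1, x2, y1, y2, z). (x1, x2)) = (\<lambda>w. (x1 w, x2 w))"
    by (auto simp: proj)
  then have ci: "pmf_cmi b r y1 y2 (\<lambda>w. (x1 w, x2 w)) = 0" "pmf_cmi b r y1 z (\<lambda>w. (x1 w, x2 w)) = 0"
    using ci_y ci_z b by (auto simp: pmf_cmi_Gibbs proj)
  note Kc = pmf_entropy_map_cong[where p = r and b = b]
  have Keqs:
    "?K (\<lambda>w. (x2 w, x1 w)) = ?K (\<lambda>w. (x1 w, x2 w))"
    "?K (\<lambda>w. (y2 w, x1 w, x2 w)) = ?K (\<lambda>w. (x1 w, x2 w, y2 w))"
    "?K (\<lambda>w. (y1 w, y2 w, x1 w, x2 w)) = ?K (\<lambda>w. (x1 w, x2 w, y1 w, y2 w))"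
    "?K (\<lambda>w. (y1 w, x2 w, x1 w)) = ?K (\<lambda>w. (y1 w, x1 w, x2 w))"
    "?K (\<lambda>w. (z w, x1 w)) = ?K (\<lambda>w. (x1 w, z w))"
    "?K (\<lambda>w. (y1 w, z w, x1 w)) = ?K (\<lambda>w. (x1 w, y1 w, z w))"
    "?K (\<lambda>w. (y1 w, x1 w, z w)) = ?K (\<lambda>w. (x1 w, y1 w, z w))"
    "?K (\<lambda>w. (x2 w, x1 w, z w)) = ?K (\<lambda>w. (z w, x1 w, x2 w))"
    "?K (\<lambda>w. (y1 w, x2 w, x1 w, z w)) = ?K (\<lambda>w. (y1 w, z w, x1 w, x2 w))"
    by (rule Kc; auto)+
  \<comment> \<open>Both expansions of the information between \<open>y1\<close> and
    \<open>(x2, z)\<close> given \<open>x1\<close>; the term for \<open>z\<close> given both inputs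
    is 0 by \<open>ci(2)\<close>.\<close>
  have diff: "pmf_cmi b r y1 x2 x1 - pmf_cmi b r y1 z x1 = pmf_cmi b r y1 x2 (\<lambda>w. (x1 w, z w))"
    using ci(2) by (simp add: pmf_cmi_def Keqs)
  \<comment> \<open>\<open>?hv\<close> cancels, and \<open>ci(1)\<close> removes \<open>y2\<close>
    from the conditional entropy of \<open>y1\<close> given the inputs. On the right the entropies
    of \<open>(y1, x1)\<close> and \<open>x1\<close> cancel.\<close>
  have eq: "CMI b M V1 (\<lambda>\<omega>. (X2 \<omega>, Y2 \<omega>, (X1 \<oplus> X1') \<omega>, (Y1 \<oplus> Y1') \<omega>)) (\<lambda>\<omega>. (X2' \<omega>, Y2' \<omega>))
          - MI b M (\<lambda>\<omega>. (V1 \<omega>, V2 \<omega>))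
              (\<lambda>\<omega>. (Z \<omega>, (X1 \<oplus> X1') \<omega>, (Y1 \<oplus> Y1') \<omega>, (X2 \<oplus> X2') \<omega>, (Y2 \<oplus> Y2') \<omega>))
          = CMI b M Y1 X2 X1 - CMI b M Y1 Z X1"
    unfolding main leak c_x c_z using ci(1) by (simp add: pmf_cmi_def Keqs)
  have "CMI b M V2 (\<lambda>\<omega>. (X1 \<omega>, Y1 \<omega>, (X2 \<oplus> X2') \<omega>, (Y2 \<oplus> Y2') \<omega>)) (\<lambda>\<omega>. (X1' \<omega>, Y1' \<omega>)) =
    pmf_cmi b (map_pmf E p) (\<lambda>t. 0::nat) (\<lambda>((v, x', y'), u, w). (x1 w, y1 w, x2 w + fst u, y2 w + snd u))
      (\<lambda>((v, x', y'), u, w). (x', y'))"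
    by (rule cmi) (auto simp: proj V2_0)
  also have "\<dots> = 0"
    by (rule pmf_cmi_const)
  finally have helper: "CMI b M V2 (\<lambda>\<omega>. (X1 \<omega>, Y1 \<omega>, (X2 \<oplus> X2') \<omega>, (Y2 \<oplus> Y2') \<omega>)) (\<lambda>\<omega>. (X1' \<omega>, Y1' \<omega>)) = 0" .
  have gib: "0 \<le> pmf_cmi b r y1 x2 (\<lambda>w. (x1 w, z w))"
    "pmf_cmi b r y1 x2 (\<lambda>w. (x1 w, z w)) = 0 \<longleftrightarrow> pmf_cond_indep r y1 x2 (\<lambda>w. (x1 w, z w))"
    using b by (auto simp: pmf_cmi_Gibbs)
  show ?thesis
    using eq helper gib unfolding c_x c_z iff diff by linarith
qed

lemma sender_helper_law:
  fixes V Y' :: "'w \<Rightarrow> 'y::{finite,field}" and X' :: "'w \<Rightarrow> 'x::{finite,field}"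
    and A' :: "'w \<Rightarrow> 'a::{finite,field}" and B' :: "'w \<Rightarrow> 'b::{finite,field}"
    and C :: "'w \<Rightarrow> 'c::finite"
  assumes M: "prob_space M"
    and ind: "indep_triple M (\<lambda>\<omega>. (V \<omega>, X' \<omega>, Y' \<omega>)) (\<lambda>\<omega>. (A' \<omega>, B' \<omega>)) C"
    and C: "has_law M C r"
    and s: "sender_aux M V X' Y'" and h: "helper_aux M U A' B'"
  shows "has_law M (\<lambda>\<omega>. ((V \<omega>, X' \<omega>, Y' \<omega>), (A' \<omega>, B' \<omega>), C \<omega>))
    (pair_pmf (map_pmf (\<lambda>v. (v, 0, v)) (pmf_of_set UNIV)) (pair_pmf (pmf_of_set UNIV) r))"
proof -
  obtain p where p: "has_law M (\<lambda>\<omega>. (V \<omega>, X' \<omega>, Y' \<omega>)) p"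
    using has_law_exists[OF indep_triple_measurable(1)[OF M ind] M] .
  obtain q where q: "has_law M (\<lambda>\<omega>. (A' \<omega>, B' \<omega>)) q"
    using has_law_exists[OF indep_triple_measurable(2)[OF M ind] M] .
  show ?thesis
    using indep_triple_has_law[OF M ind p q C] sender_law[OF s p] helper_law[OF M h q] by simp
qed

text \<open>The transposition \<open>\<pi>\<close> of 0 and 1 is its own inverse: the product rule
  for \<open>S\<close> on \<open>J\<close> is the given one for the reindexed events on the image of
  \<open>J\<close>.\<close>

lemma indep_triple_commute:
  assumes "prob_space M" "indep_triple M A B C"
  shows "indep_triple M B A C"
proof -
  interpret prob_space M by fact
  define \<pi> :: "nat \<Rightarrow> nat" where "\<pi> i = [1, 0, 2] ! i" for i
  have "indep_sets (\<lambda>i. [rv_events M A, rv_events M B, rv_events M C] ! \<pi> i) {0, 1, 2}"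
    unfolding indep_sets_def
  proof (intro conjI ballI allI impI)
    fix i :: nat assume "i \<in> {0, 1, 2}"
    then have "\<pi> i \<in> {0, 1, 2}"
      by (auto simp: \<pi>_def)
    then show "[rv_events M A, rv_events M B, rv_events M C] ! \<pi> i \<subseteq> events"
      using assms(2) unfolding indep_triple_def indep_sets_def by blast
  next
    fix J :: "nat set" and S
    assume J: "J \<subseteq> {0, 1, 2}" "J \<noteq> {}" "finite J"
      and S: "S \<in> Pi J (\<lambda>i. [rv_events M A, rv_events M B, rv_events M C] ! \<pi> i)"
    have inv: "\<pi> (\<pi> i) = i" if "i \<in> {0, 1, 2}" for i
      using that by (auto simp: \<pi>_def)
    have inj: "inj_on \<pi> J"
      using J by (intro inj_on_inverseI[of _ \<pi>] inv) auto
    have "prob (\<Inter>j\<in>\<pi> ` J. S (\<pi> j)) = (\<Prod>j\<in>\<pi> ` J. prob (S (\<pi> j)))"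
      using assms(2) unfolding indep_triple_def
    proof (rule indep_setsD)
      show "\<pi> ` J \<subseteq> {0, 1, 2}"
        using J by (auto simp: \<pi>_def)
      show "\<forall>j\<in>\<pi> ` J. S (\<pi> j) \<in> [rv_events M A, rv_events M B, rv_events M C] ! j"
        using S J inv by (auto simp: Pi_iff subset_iff)
    qed (use J in auto)
    also have "(\<Prod>j\<in>\<pi> ` J. prob (S (\<pi> j))) = (\<Prod>j\<in>J. prob (S j))"
      using J inv by (subst prod.reindex[OF inj]) (auto intro!: prod.cong simp: subset_iff)
    also have "(\<Inter>j\<in>\<pi> ` J. S (\<pi> j)) = (\<Inter>j\<in>J. S j)"
      using J inv by (auto simp: subset_iff)
    finally show "prob (\<Inter>j\<in>J. S j) = (\<Prod>j\<in>J. prob (S j))" .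
  qed
  then show ?thesis
    unfolding indep_triple_def
    by (rule indep_sets_mono_sets) (auto simp: \<pi>_def)
qed

text \<open>Strict positivity cannot be asserted outright: for a deterministic \<open>X2\<close>, or
  a channel \<open>W\<close> that ignores the input of User 2, the first difference is 0. The sign
  is therefore stated as nonnegativity together with the exact condition for strictness.\<close>

theorem theorem2:
  fixes M :: "'w measure" and b :: real
    and W :: "('x1::{finite,field}, 'x2::{finite,field}, 'y1::{finite,field}, 'y2::{finite,field},
               'z::finite) two_way_channel"
    and P1 :: "'x1 pmf" and P2 :: "'x2 pmf"
    and X1 :: "'w \<Rightarrow> 'x1" and X2 :: "'w \<Rightarrow> 'x2"
    and Y1 :: "'w \<Rightarrow> 'y1" and Y2 :: "'w \<Rightarrow> 'y2" and Z :: "'w \<Rightarrow> 'z"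
  assumes "prob_space M" and "1 < b"
    and "cond_indep_channel W"
    and "channel_use M W P1 P2 X1 X2 Y1 Y2 Z"
  shows
    "(\<forall>(V1 :: 'w \<Rightarrow> 'y1) (X1' :: 'w \<Rightarrow> 'x1) (Y1' :: 'w \<Rightarrow> 'y1)
       (V2 :: 'w \<Rightarrow> nat) (X2' :: 'w \<Rightarrow> 'x2) (Y2' :: 'w \<Rightarrow> 'y2).
        indep_triple M (\<lambda>\<omega>. (V1 \<omega>, X1' \<omega>, Y1' \<omega>)) (\<lambda>\<omega>. (V2 \<omega>, X2' \<omega>, Y2' \<omega>))
          (\<lambda>\<omega>. (X1 \<omega>, X2 \<omega>, Y1 \<omega>, Y2 \<omega>, Z \<omega>)) \<longrightarrow>
        sender_aux M V1 X1' Y1' \<longrightarrow> helper_aux M V2 X2' Y2' \<longrightarrow>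
        CMI b M V1 (\<lambda>\<omega>. (X2 \<omega>, Y2 \<omega>, (X1 \<oplus> X1') \<omega>, (Y1 \<oplus> Y1') \<omega>)) (\<lambda>\<omega>. (X2' \<omega>, Y2' \<omega>))
          - MI b M (\<lambda>\<omega>. (V1 \<omega>, V2 \<omega>))
              (\<lambda>\<omega>. (Z \<omega>, (X1 \<oplus> X1') \<omega>, (Y1 \<oplus> Y1') \<omega>, (X2 \<oplus> X2') \<omega>, (Y2 \<oplus> Y2') \<omega>))
          = CMI b M Y1 X2 X1 - CMI b M Y1 Z X1 \<and>
        CMI b M Y1 X2 X1 - CMI b M Y1 Z X1 \<ge> 0 \<and>
        (CMI b M Y1 X2 X1 - CMI b M Y1 Z X1 > 0 \<longleftrightarrow>
           \<not> cond_indep_rv M Y1 X2 (\<lambda>\<omega>. (X1 \<omega>, Z \<omega>))) \<and>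
        CMI b M V2 (\<lambda>\<omega>. (X1 \<omega>, Y1 \<omega>, (X2 \<oplus> X2') \<omega>, (Y2 \<oplus> Y2') \<omega>)) (\<lambda>\<omega>. (X1' \<omega>, Y1' \<omega>)) = 0)
     \<and>
     (\<forall>(V1 :: 'w \<Rightarrow> nat) (X1' :: 'w \<Rightarrow> 'x1) (Y1' :: 'w \<Rightarrow> 'y1)
       (V2 :: 'w \<Rightarrow> 'y2) (X2' :: 'w \<Rightarrow> 'x2) (Y2' :: 'w \<Rightarrow> 'y2).
        indep_triple M (\<lambda>\<omega>. (V1 \<omega>, X1' \<omega>, Y1' \<omega>)) (\<lambda>\<omega>. (V2 \<omega>, X2' \<omega>, Y2' \<omega>))
          (\<lambda>\<omega>. (X1 \<omega>, X2 \<omega>, Y1 \<omega>, Y2 \<omega>, Z \<omega>)) \<longrightarrow>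
        sender_aux M V2 X2' Y2' \<longrightarrow> helper_aux M V1 X1' Y1' \<longrightarrow>
        CMI b M V2 (\<lambda>\<omega>. (X1 \<omega>, Y1 \<omega>, (X2 \<oplus> X2') \<omega>, (Y2 \<oplus> Y2') \<omega>)) (\<lambda>\<omega>. (X1' \<omega>, Y1' \<omega>))
          - MI b M (\<lambda>\<omega>. (V2 \<omega>, V1 \<omega>))
              (\<lambda>\<omega>. (Z \<omega>, (X2 \<oplus> X2') \<omega>, (Y2 \<oplus> Y2') \<omega>, (X1 \<oplus> X1') \<omega>, (Y1 \<oplus> Y1') \<omega>))
          = CMI b M Y2 X1 X2 - CMI b M Y2 Z X2 \<and>
        CMI b M Y2 X1 X2 - CMI b M Y2 Z X2 \<ge> 0 \<and>
        (CMI b M Y2 X1 X2 - CMI b M Y2 Z X2 > 0 \<longleftrightarrow>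
           \<not> cond_indep_rv M Y2 X1 (\<lambda>\<omega>. (X2 \<omega>, Z \<omega>))) \<and>
        CMI b M V1 (\<lambda>\<omega>. (X2 \<omega>, Y2 \<omega>, (X1 \<oplus> X1') \<omega>, (Y1 \<oplus> Y1') \<omega>)) (\<lambda>\<omega>. (X2' \<omega>, Y2' \<omega>)) = 0)"
proof -
  note M = \<open>prob_space M\<close> and b = \<open>1 < b\<close>
  let ?O = "\<lambda>\<omega>. (X1 \<omega>, X2 \<omega>, Y1 \<omega>, Y2 \<omega>, Z \<omega>)"
  let ?swap = "\<lambda>(x1, x2, y1, y2, z). (x2, x1, y2, y1, z)"
  obtain r where r: "has_law M ?O r"
    and pmf_r: "\<And>x1 x2 y1 y2 z.
      pmf r (x1, x2, y1, y2, z) = pmf P1 x1 * pmf P2 x2 * pmf (W x1 x2) (y1, y2, z)"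
    using channel_use_law[OF M assms(4)] by blast
  note ci = channel_cond_indep_outputs[OF assms(3) pmf_r] channel_cond_indep_1[OF assms(3) pmf_r]
    channel_cond_indep_2[OF assms(3) pmf_r]
  have r': "has_law M (\<lambda>\<omega>. (X2 \<omega>, X1 \<omega>, Y2 \<omega>, Y1 \<omega>, Z \<omega>)) (map_pmf ?swap r)"
    by (rule has_law_comp[OF r]) simp
  \<comment> \<open>Conditional independence is carried over as vanishing of \<open>pmf_cmi\<close>,
    which is insensitive to the order of the two variables and to recoding of the condition.\<close>
  have swapped: "pmf_cond_indep (map_pmf ?swap r) f g h" if "pmf_cond_indep r f' g' h'"
    and "pmf_cmi b r f' g' h' = pmf_cmi b r (\<lambda>t. f (?swap t)) (\<lambda>t. g (?swap t)) (\<lambda>t. h (?swap t))"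
    for f :: "_ \<Rightarrow> 's::finite" and g :: "_ \<Rightarrow> 't::finite" and h :: "_ \<Rightarrow> 'u::finite"
      and f' :: "_ \<Rightarrow> 's1::finite" and g' :: "_ \<Rightarrow> 't1::finite" and h' :: "_ \<Rightarrow> 'u1::finite"
    using that b by (simp add: pmf_cmi_def map_pmf_comp flip: pmf_cmi_Gibbs(2)[OF _ b])
  have ci': "pmf_cond_indep (map_pmf ?swap r) (\<lambda>(x2, x1, y2, y1, z). y2) (\<lambda>(x2, x1, y2, y1, z). y1)
      (\<lambda>(x2, x1, y2, y1, z). (x2, x1))"
    "pmf_cond_indep (map_pmf ?swap r) (\<lambda>(x2, x1, y2, y1, z). y2) (\<lambda>(x2, x1, y2, y1, z). z)
      (\<lambda>(x2, x1, y2, y1, z). (x2, x1))"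
  proof -
    show "pmf_cond_indep (map_pmf ?swap r) (\<lambda>(x2, x1, y2, y1, z). y2) (\<lambda>(x2, x1, y2, y1, z). y1)
      (\<lambda>(x2, x1, y2, y1, z). (x2, x1))"
      by (rule swapped[OF ci(1)], subst pmf_cmi_commute, simp add: case_prod_unfold,
        rule pmf_cmi_cong_given) auto
    show "pmf_cond_indep (map_pmf ?swap r) (\<lambda>(x2, x1, y2, y1, z). y2) (\<lambda>(x2, x1, y2, y1, z). z)
      (\<lambda>(x2, x1, y2, y1, z). (x2, x1))"
      by (rule swapped[OF ci(3)], simp add: case_prod_unfold, rule pmf_cmi_cong_given) auto
  qed
  show ?thesis
  proof (rule conjI; intro allI impI)
    fix V1 :: "'w \<Rightarrow> 'y1" and X1' :: "'w \<Rightarrow> 'x1" and Y1' :: "'w \<Rightarrow> 'y1"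
      and V2 :: "'w \<Rightarrow> nat" and X2' :: "'w \<Rightarrow> 'x2" and Y2' :: "'w \<Rightarrow> 'y2"
    assume ind: "indep_triple M (\<lambda>\<omega>. (V1 \<omega>, X1' \<omega>, Y1' \<omega>)) (\<lambda>\<omega>. (V2 \<omega>, X2' \<omega>, Y2' \<omega>)) ?O"
      and s: "sender_aux M V1 X1' Y1'" and h: "helper_aux M V2 X2' Y2'"
    have "indep_triple M (\<lambda>\<omega>. (V1 \<omega>, X1' \<omega>, Y1' \<omega>)) (\<lambda>\<omega>. (X2' \<omega>, Y2' \<omega>)) ?O"
      \<comment> \<open>Taking \<open>snd\<close> drops the constant \<open>V2\<close> from the
        second component.\<close>
      using indep_triple_comp[OF M ind, where f = "\<lambda>t. t" and g = snd and h = "\<lambda>t. t"] by simp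
    then have law: "has_law M (\<lambda>\<omega>. ((V1 \<omega>, X1' \<omega>, Y1' \<omega>), (X2' \<omega>, Y2' \<omega>), ?O \<omega>))
      (pair_pmf (map_pmf (\<lambda>v. (v, 0, v)) (pmf_of_set UNIV)) (pair_pmf (pmf_of_set UNIV) r))"
      using r s h by (rule sender_helper_law[OF M])
    have "V2 \<in> space M \<rightarrow> {0}"
      using h by (simp add: helper_aux_def)
    from one_sided_rates[OF M b law this ci(1,2)]
    show "CMI b M V1 (\<lambda>\<omega>. (X2 \<omega>, Y2 \<omega>, (X1 \<oplus> X1') \<omega>, (Y1 \<oplus> Y1') \<omega>)) (\<lambda>\<omega>. (X2' \<omega>, Y2' \<omega>))
          - MI b M (\<lambda>\<omega>. (V1 \<omega>, V2 \<omega>))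
              (\<lambda>\<omega>. (Z \<omega>, (X1 \<oplus> X1') \<omega>, (Y1 \<oplus> Y1') \<omega>, (X2 \<oplus> X2') \<omega>, (Y2 \<oplus> Y2') \<omega>))
          = CMI b M Y1 X2 X1 - CMI b M Y1 Z X1 \<and>
        CMI b M Y1 X2 X1 - CMI b M Y1 Z X1 \<ge> 0 \<and>
        (CMI b M Y1 X2 X1 - CMI b M Y1 Z X1 > 0 \<longleftrightarrow>
           \<not> cond_indep_rv M Y1 X2 (\<lambda>\<omega>. (X1 \<omega>, Z \<omega>))) \<and>
        CMI b M V2 (\<lambda>\<omega>. (X1 \<omega>, Y1 \<omega>, (X2 \<oplus> X2') \<omega>, (Y2 \<oplus> Y2') \<omega>)) (\<lambda>\<omega>. (X1' \<omega>, Y1' \<omega>)) = 0" .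
  next
    fix V1 :: "'w \<Rightarrow> nat" and X1' :: "'w \<Rightarrow> 'x1" and Y1' :: "'w \<Rightarrow> 'y1"
      and V2 :: "'w \<Rightarrow> 'y2" and X2' :: "'w \<Rightarrow> 'x2" and Y2' :: "'w \<Rightarrow> 'y2"
    assume ind: "indep_triple M (\<lambda>\<omega>. (V1 \<omega>, X1' \<omega>, Y1' \<omega>)) (\<lambda>\<omega>. (V2 \<omega>, X2' \<omega>, Y2' \<omega>)) ?O"
      and s: "sender_aux M V2 X2' Y2'" and h: "helper_aux M V1 X1' Y1'"
    have "indep_triple M (\<lambda>\<omega>. (V2 \<omega>, X2' \<omega>, Y2' \<omega>)) (\<lambda>\<omega>. (X1' \<omega>, Y1' \<omega>))
        (\<lambda>\<omega>. (X2 \<omega>, X1 \<omega>, Y2 \<omega>, Y1 \<omega>, Z \<omega>))"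
      using indep_triple_comp[OF M indep_triple_commute[OF M ind],
          where f = "\<lambda>t. t" and g = snd and h = ?swap] by simp
    then have law: "has_law M (\<lambda>\<omega>. ((V2 \<omega>, X2' \<omega>, Y2' \<omega>), (X1' \<omega>, Y1' \<omega>),
        (X2 \<omega>, X1 \<omega>, Y2 \<omega>, Y1 \<omega>, Z \<omega>)))
      (pair_pmf (map_pmf (\<lambda>v. (v, 0, v)) (pmf_of_set UNIV))
        (pair_pmf (pmf_of_set UNIV) (map_pmf ?swap r)))"
      using r' s h by (rule sender_helper_law[OF M])
    have "V1 \<in> space M \<rightarrow> {0}"
      using h by (simp add: helper_aux_def)
    from one_sided_rates[OF M b law this ci']
    show "CMI b M V2 (\<lambda>\<omega>. (X1 \<omega>, Y1 \<omega>, (X2 \<oplus> X2') \<omega>, (Y2 \<oplus> Y2') \<omega>)) (\<lambda>\<omega>. (X1' \<omega>, Y1' \<omega>))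
          - MI b M (\<lambda>\<omega>. (V2 \<omega>, V1 \<omega>))
              (\<lambda>\<omega>. (Z \<omega>, (X2 \<oplus> X2') \<omega>, (Y2 \<oplus> Y2') \<omega>, (X1 \<oplus> X1') \<omega>, (Y1 \<oplus> Y1') \<omega>))
          = CMI b M Y2 X1 X2 - CMI b M Y2 Z X2 \<and>
        CMI b M Y2 X1 X2 - CMI b M Y2 Z X2 \<ge> 0 \<and>
        (CMI b M Y2 X1 X2 - CMI b M Y2 Z X2 > 0 \<longleftrightarrow>
           \<not> cond_indep_rv M Y2 X1 (\<lambda>\<omega>. (X2 \<omega>, Z \<omega>))) \<and>
        CMI b M V1 (\<lambda>\<omega>. (X2 \<omega>, Y2 \<omega>, (X1 \<oplus> X1') \<omega>, (Y1 \<oplus> Y1') \<omega>)) (\<lambda>\<omega>. (X2' \<omega>, Y2' \<omega>)) = 0" .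
  qed
qed

end
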